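(* Fix a nonempty $S\subseteq[n]$ with $|S|=s$ and $Q\in\mathbb R^{q\times k_0}$. Suppose the vector-valued linear model $f(Y)=\beta_SX_S+\varepsilon_S$ holds, that $$\max\Big\{\sup_{\|\theta\|_2=1}\mathbb E[\langle X_S,\theta\rangle^4]^{1/4},\ \big\|\,\|X_S\|_2\,\big\|_{\psi_1}\Big\}\le K<\infty$$ for some $K\ge1$, and that $\Lambda_S=\mathbb E[X_SX_S^T]$ is invertible. Then there exist a constant $C>0$ and an integer $m_0$, not depending on the number $m$ of exploration samples nor on the budget $B$, such that for every $m\ge m_0$ (and every $B$ for which $N_S\ge1$), with probability at least $1-m^{-2}$, $$\mathrm{Risk}_S|_{\widehat\beta_S}\ \le\ C\left(\frac1{N_S}\mathrm{tr}(\Sigma_S\beta_S^TQ^TQ\beta_S)+(s+1)\,\mathrm{tr}(Q\Gamma_SQ^T)\,\frac{\log m}{m}\right).$$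
   Context: Setting. $X^{(1)},\dots,X^{(n)}$ are real random variables and $f(Y)=(f^{(1)}(Y),\dots,f^{(k_0)}(Y))^T$ is an $\mathbb R^{k_0}$-valued random vector on a common probability space, with sampling costs $c_1,\dots,c_n>0$ and $c_0>0$ respectively. For nonempty $S\subseteq[n]=\{1,\dots,n\}$ with $|S|=s$, $X_S=(1,(X^{(i)})_{i\in S})^T\in\mathbb R^{s+1}$. The vector-valued linear model assumption is $f(Y)=\beta_SX_S+\varepsilon_S$ with $\beta_S\in\mathbb R^{k_0\times(s+1)}$ deterministic and $\varepsilon_S\in\mathbb R^{k_0}$ a centered multivariate sub-Gaussian vector with covariance matrix $\Gamma_S$, independent of $X_S$. Write $\Sigma_S=\mathrm{Cov}[X_S]$. For a random variable $W$ and $\alpha\ge1$, $\|W\|_{\psi_\alpha}=\inf\{C>0:\mathbb E[\exp(|W|^\alpha/C^\alpha)]\le2\}$. Exploration. $m>n+1$ i.i.d. joint samples $(X^{(1)}_\ell,\dots,X^{(n)}_\ell,f(Y_\ell))$, $\ell\in[m]$, are drawn. $Z_S$ is the $m\times(s+1)$ design matrix whose $\ell$-th row is $(1,(X^{(i)}_\ell)_{i\in S})$, assumed throughout to have full column rank; with $Z_S^\dagger=(Z_S^TZ_S)^{-1}Z_S^T$, the coefficient estimator $\widehat\beta_S\in\mathbb R^{k_0\times(s+1)}$ is the least squares estimator $\widehat\beta_S=(f(Y_1),\dots,f(Y_m))(Z_S^\dagger)^T$ (row by row ordinary least squares). Exploitation. With total budget $B>0$, $c_{\mathrm{epr}}=\sum_{i=0}^nc_i$,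 $c_{\mathrm{ept}}(S)=\sum_{i\in S}c_i$, let $N_S=\lfloor(B-c_{\mathrm{epr}}m)/c_{\mathrm{ept}}(S)\rfloor$. Draw $N_S$ i.i.d. samples $X_{S,\ell}$ of $X_S$, independent of the exploration samples, and set $$\mathrm{LRMC}_S=\frac1{N_S}\sum_{\ell\in[N_S]}\widehat\beta_SX_{S,\ell},\qquad \mathrm{Risk}_S|_{\widehat\beta_S}=\mathbb E\big[\|Q(\mathrm{LRMC}_S-\mathbb E[f(Y)])\|_2^2\,\big|\,\widehat\beta_S\big].$$ The probability in the claim is over the exploration data. *)

theory Defs
  imports "HOL-Probability.Probability"
begin

section \<open>Random vectors\<close>

text \<open>
  The Orlicz norm is extended-real valued: the infimum of the empty set is \<open>\<infinity>\<close>, and the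
  expectation is a nonnegative integral, so that a divergent exponential moment counts as \<open>\<infinity>\<close>.
\<close>

definition psi_norm :: "'a measure \<Rightarrow> real \<Rightarrow> ('a \<Rightarrow> real) \<Rightarrow> ennreal" where
  "psi_norm M \<alpha> W =
     Inf {ennreal C | C. C > 0 \<and>
       (\<integral>\<^sup>+ \<omega>. ennreal (exp (\<bar>W \<omega>\<bar> powr \<alpha> / C powr \<alpha>)) \<partial>M) \<le> 2}"

definition sub_gaussian_vec :: "'a measure \<Rightarrow> ('a \<Rightarrow> real ^ 'd) \<Rightarrow> bool" where
  "sub_gaussian_vec M V \<longleftrightarrow>
     V \<in> borel_measurable M \<and> (SUP \<theta>\<in>sphere 0 1. psi_norm M 2 (\<lambda>\<omega>. V \<omega> \<bullet> \<theta>)) < \<infinity>"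

definition cov_matrix :: "'a measure \<Rightarrow> ('a \<Rightarrow> real ^ 'd) \<Rightarrow> real ^ 'd ^ 'd" where
  "cov_matrix M V =
     (\<chi> i j. \<integral>\<omega>. (V \<omega> $ i - (\<integral>\<omega>'. V \<omega>' $ i \<partial>M)) * (V \<omega> $ j - (\<integral>\<omega>'. V \<omega>' $ j \<partial>M)) \<partial>M)"

definition second_moment_matrix :: "'a measure \<Rightarrow> ('a \<Rightarrow> real ^ 'd) \<Rightarrow> real ^ 'd ^ 'd" where
  "second_moment_matrix M V = (\<chi> i j. \<integral>\<omega>. V \<omega> $ i * V \<omega> $ j \<partial>M)"

text \<open>
  Unlike \<^const>\<open>prob_space.indep_var\<close>, this allows the two variables to have different value types.
\<close>

definition indep_rv ::
    "'a measure \<Rightarrow> 'b measure \<Rightarrow> ('a \<Rightarrow> 'b) \<Rightarrow> 'c measure \<Rightarrow> ('a \<Rightarrow> 'c) \<Rightarrow> bool" where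
  "indep_rv M A U B V \<longleftrightarrow>
     U \<in> measurable M A \<and> V \<in> measurable M B \<and>
     prob_space.indep_set M {U -` a \<inter> space M | a. a \<in> sets A} {V -` b \<inter> space M | b. b \<in> sets B}"

definition iid_samples ::
    "'b measure \<Rightarrow> 'i set \<Rightarrow> ('i \<Rightarrow> 'b \<Rightarrow> 'c::topological_space) \<Rightarrow> 'c measure \<Rightarrow> bool" where
  "iid_samples P I W D \<longleftrightarrow>
     prob_space.indep_vars P (\<lambda>_. borel) W I \<and> (\<forall>l\<in>I. distr P borel (W l) = D)"

section \<open>The regressor vector and least squares\<close>

text \<open>
  The index set \<open>[n]\<close> is the finite type \<open>'n\<close>. A subset \<open>S\<close> of size \<open>s\<close> is enumerated by a
  bijection \<open>\<sigma>\<close> from a finite type \<open>'s\<close> onto \<open>S\<close>, so that \<open>real ^ ('s option)\<close> is the space of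
  dimension \<open>s + 1\<close>; the coordinate \<open>None\<close> carries the intercept.
\<close>

definition regressor :: "('s::finite \<Rightarrow> 'n) \<Rightarrow> real ^ 'n \<Rightarrow> real ^ ('s option)" where
  "regressor \<sigma> x = (\<chi> j. case j of None \<Rightarrow> 1 | Some i \<Rightarrow> x $ \<sigma> i)"

text \<open>
  A matrix with \<open>m\<close> rows, \<open>m\<close> a variable, is the family \<open>Z\<close> of its rows \<open>Z 1, \<dots>, Z m\<close>.
  Full column rank uses the library's definition of rank, the dimension of the set of rows.
\<close>

definition full_column_rank :: "nat \<Rightarrow> (nat \<Rightarrow> real ^ 'd) \<Rightarrow> bool" where
  "full_column_rank m Z \<longleftrightarrow> dim (Z ` {1..m}) = CARD('d)"

definition gram :: "nat \<Rightarrow> (nat \<Rightarrow> real ^ 'd) \<Rightarrow> real ^ 'd ^ 'd" where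
  "gram m Z = (\<chi> i j. \<Sum>l = 1..m. Z l $ i * Z l $ j)"

text \<open>The \<open>l\<close>-th column of \<open>(Z\<^sup>T Z)\<^sup>-\<^sup>1 Z\<^sup>T\<close>.\<close>

definition pinv_col :: "nat \<Rightarrow> (nat \<Rightarrow> real ^ 'd) \<Rightarrow> nat \<Rightarrow> real ^ 'd" where
  "pinv_col m Z l = matrix_inv (gram m Z) *v Z l"

definition ols :: "nat \<Rightarrow> (nat \<Rightarrow> real ^ 'd) \<Rightarrow> (nat \<Rightarrow> real ^ 'k) \<Rightarrow> real ^ 'd ^ 'k" where
  "ols m Z F = (\<chi> a j. \<Sum>l = 1..m. F l $ a * pinv_col m Z l $ j)"

section \<open>Exploration and exploitation\<close>

definition num_exploit :: "real \<Rightarrow> ('n::finite \<Rightarrow> real) \<Rightarrow> 'n set \<Rightarrow> real \<Rightarrow> nat \<Rightarrow> nat" where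
  "num_exploit c0 c S B m =
     nat \<lfloor>(B - (c0 + (\<Sum>i\<in>UNIV. c i)) * real m) / (\<Sum>i\<in>S. c i)\<rfloor>"

definition beta_hat ::
    "('s::finite \<Rightarrow> 'n) \<Rightarrow> nat \<Rightarrow> (nat \<Rightarrow> 'b \<Rightarrow> (real ^ 'n) \<times> (real ^ 'k)) \<Rightarrow> 'b \<Rightarrow> real ^ ('s option) ^ 'k" where
  "beta_hat \<sigma> m W \<omega> = ols m (\<lambda>l. regressor \<sigma> (fst (W l \<omega>))) (\<lambda>l. snd (W l \<omega>))"

definition lrmc ::
    "('b \<Rightarrow> real ^ 'd ^ 'k) \<Rightarrow> nat \<Rightarrow> (nat \<Rightarrow> 'b \<Rightarrow> real ^ 'd) \<Rightarrow> 'b \<Rightarrow> real ^ 'k" where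
  "lrmc bh N V \<omega> = (1 / real N) *\<^sub>R (\<Sum>l = 1..N. bh \<omega> *v V l \<omega>)"

text \<open>
  The squared error need not be integrable, as \<open>bh\<close> may lack moments, so the
  conditional expectation given \<open>bh\<close> is the one for nonnegative functions, with values in \<open>[0, \<infinity>]\<close>.
\<close>

definition cond_risk ::
    "'b measure \<Rightarrow> real ^ 'k ^ 'q \<Rightarrow> real ^ 'k \<Rightarrow> ('b \<Rightarrow> real ^ 'd ^ 'k) \<Rightarrow> nat \<Rightarrow>
     (nat \<Rightarrow> 'b \<Rightarrow> real ^ 'd) \<Rightarrow> 'b \<Rightarrow> ennreal" where
  "cond_risk P Q \<mu> bh N V =
     nn_cond_exp P (vimage_algebra (space P) bh borel)
       (\<lambda>\<omega>. ennreal ((norm (Q *v (lrmc bh N V \<omega> - \<mu>)))\<^sup>2))"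

end

theory Submission
  imports Defs "HOL-Real_Asymp.Real_Asymp"
begin

text \<open>
  Write \<open>\<Delta>\<close> for the error of the least squares estimator. Splitting
  \<open>Q (\<beta>\<^sub>h X\<^sub>N - \<beta> \<mu>) = Q \<Delta> X\<^sub>N + Q \<beta> (X\<^sub>N - \<mu>)\<close>, with \<open>\<beta>\<^sub>h\<close> the estimator and \<open>X\<^sub>N\<close> the mean of the exploitation
  samples, bounds the conditional risk by \<open>2/N\<close> times the first trace plus a multiple of the squared
  Frobenius norm of \<open>Q \<Delta>\<close>.

  Two events control \<open>\<Delta>\<close>. First, the Gram matrix dominates \<open>\<kappa> m\<close> times the identity: discarding the
  samples with \<open>norm z > R\<close> only decreases the Gram matrix, the truncated second moment matrix is still
  coercive for large \<open>R\<close>, and Hoeffding's inequality applies to the entries of the truncated sum.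
  Second, given the design, each entry of \<open>\<Delta>\<close> is a weighted sum of independent centred sub-Gaussian
  variables whose squared weights add up to a diagonal entry of the inverse Gram matrix, hence to at most
  \<open>1/(\<kappa> m)\<close>; a Chernoff bound makes it \<open>O(sqrt (log m / m))\<close> up to probability \<open>2/m\<^sup>3\<close>.
  No upper bound on the Gram matrix is needed. If \<open>tr (Q \<Gamma> Q\<^sup>T) = 0\<close>, then \<open>Q \<epsilon> = 0\<close> and \<open>Q \<Delta> = 0\<close>
  almost surely; otherwise this trace is a positive constant, absorbed by \<open>C\<close>.
\<close>

section \<open>Independence and sub-Gaussian variables\<close>

text \<open>Rectangles determine a product measure, and the preimage of a rectangle is an
  intersection of one event from each of the two independent families. In the form of a product law,
  independence can be combined with Fubini.\<close>

lemma indep_rv_distr_pair: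
  assumes "prob_space M" and "indep_rv M A U B V"
  shows "distr M (A \<Otimes>\<^sub>M B) (\<lambda>\<omega>. (U \<omega>, V \<omega>)) = distr M A U \<Otimes>\<^sub>M distr M B V"
proof (rule sym, rule pair_measure_eqI)
  interpret prob_space M by fact
  have [measurable]: "U \<in> measurable M A" "V \<in> measurable M B"
    and ind: "indep_set {U -` a \<inter> space M | a. a \<in> sets A} {V -` b \<inter> space M | b. b \<in> sets B}"
    using assms(2) by (auto simp: indep_rv_def)
  show "sigma_finite_measure (distr M A U)" "sigma_finite_measure (distr M B V)"
    by (auto intro!: prob_space_imp_sigma_finite prob_space_distr)
  show "sets (distr M A U \<Otimes>\<^sub>M distr M B V) = sets (distr M (A \<Otimes>\<^sub>M B) (\<lambda>\<omega>. (U \<omega>, V \<omega>)))"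
    by (simp cong: sets_pair_measure_cong)
  fix a b assume "a \<in> sets (distr M A U)" "b \<in> sets (distr M B V)"
  then have [measurable]: "a \<in> sets A" "b \<in> sets B" by auto
  have "prob ((U -` a \<inter> space M) \<inter> (V -` b \<inter> space M)) = prob (U -` a \<inter> space M) * prob (V -` b \<inter> space M)"
    by (rule indep_setD[OF ind]) auto
  moreover have "(\<lambda>\<omega>. (U \<omega>, V \<omega>)) -` (a \<times> b) \<inter> space M = (U -` a \<inter> space M) \<inter> (V -` b \<inter> space M)"
    by auto
  ultimately show "emeasure (distr M A U) a * emeasure (distr M B V) b
      = emeasure (distr M (A \<Otimes>\<^sub>M B) (\<lambda>\<omega>. (U \<omega>, V \<omega>))) (a \<times> b)"
    by (subst (1 2 3) emeasure_distr) (auto simp: emeasure_eq_measure ennreal_mult'[symmetric])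
qed

text \<open>An event about \<open>f\<close> of \<open>U\<close> is the event about \<open>U\<close>
  given by the preimage under \<open>f\<close>, so independence passes to a smaller family. It
  carries independence from the exploration data to the estimator.\<close>

lemma indep_rv_compose:
  assumes "indep_rv M A U B V" "f \<in> measurable A A'" "prob_space M"
  shows "indep_rv M A' (\<lambda>\<omega>. f (U \<omega>)) B V"
proof -
  interpret prob_space M by fact
  have U: "U \<in> measurable M A" and V: "V \<in> measurable M B"
    and ind: "indep_set {U -` a \<inter> space M | a. a \<in> sets A} {V -` b \<inter> space M | b. b \<in> sets B}"
    using assms(1) by (auto simp: indep_rv_def)
  have ex: "\<exists>a'. (\<lambda>\<omega>. f (U \<omega>)) -` a \<inter> space M = U -` a' \<inter> space M \<and> a' \<in> sets A" if "a \<in> sets A'" for a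
    using measurable_sets[OF assms(2) that] measurable_space[OF U]
    by (intro exI[of _ "f -` a \<inter> space A"]) auto
  have "{(\<lambda>\<omega>. f (U \<omega>)) -` a \<inter> space M | a. a \<in> sets A'} \<subseteq> {U -` a \<inter> space M | a. a \<in> sets A}"
    (is "?L \<subseteq> ?R")
  proof
    fix x assume "x \<in> ?L"
    then obtain a where a: "a \<in> sets A'" "x = (\<lambda>\<omega>. f (U \<omega>)) -` a \<inter> space M" by auto
    from ex[OF a(1)] show "x \<in> ?R" unfolding a(2) by simp
  qed
  then have "indep_set {(\<lambda>\<omega>. f (U \<omega>)) -` a \<inter> space M | a. a \<in> sets A'} {V -` b \<inter> space M | b. b \<in> sets B}"
    using ind unfolding indep_sets2_eq by (meson subset_iff subset_trans)
  then show ?thesis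
    using U V assms(2) unfolding indep_rv_def by auto
qed

text \<open>The linear term is kept exactly because it integrates to zero for a centred variable;
  what remains is an exponential moment of the square, which the Orlicz norm with exponent 2
  controls.\<close>

lemma exp_le_add_exp_square: "exp x \<le> x + exp (x\<^sup>2)" for x :: real
proof -
  have sq: "1 + x\<^sup>2 \<le> exp (x\<^sup>2)" by (rule exp_ge_add_one_self)
  consider "x > 1" | "0 \<le> x" "x \<le> 1" | "-1 \<le> x" "x < 0" | "x < -1" by linarith
  then show ?thesis
  proof cases
    case 1
    then have "x \<le> x\<^sup>2" by (simp add: power2_eq_square)
    then have "exp x \<le> exp (x\<^sup>2)" by simp
    then show ?thesis using 1 by linarith
  next
    case 2
    then show ?thesis using exp_bound[of x] sq by linarith
  next
    case 3
    \<comment> \<open>On this range the tangent bound at -x is inverted, and 1 / (1 - x) is compared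
      with the first three terms of its geometric series.\<close>
    have "exp (- x) \<ge> 1 - x" using exp_ge_add_one_self[of "- x"] by simp
    then have "exp x \<le> 1 / (1 - x)" using 3 by (simp add: exp_minus field_simps)
    also have "\<dots> \<le> 1 + x + x\<^sup>2"
    proof -
      have "(1 + x + x\<^sup>2) * (1 - x) = 1 - x ^ 3" by (simp add: algebra_simps power2_eq_square power3_eq_cube)
      moreover have "x ^ 3 \<le> 0" using 3 by (simp add: power3_eq_cube mult_nonneg_nonpos mult_nonpos_nonpos)
      ultimately show ?thesis using 3 by (simp add: divide_le_eq)
    qed
    finally show ?thesis using sq by linarith
  next
    case 4
    have "- x \<le> x\<^sup>2" using 4 using mult_right_mono[of 1 "- x" "- x"] by (simp add: power2_eq_square)
    moreover have "exp x \<le> 1" using 4 by simp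
    ultimately show ?thesis using sq by linarith
  qed
qed

section \<open>Orlicz norms, square integrability and moment generating functions\<close>

lemma psi_norm_finiteE:
  assumes "psi_norm M \<alpha> W < \<infinity>"
  obtains C where "C > 0" "(\<integral>\<^sup>+ \<omega>. ennreal (exp (\<bar>W \<omega>\<bar> powr \<alpha> / C powr \<alpha>)) \<partial>M) \<le> 2"
proof -
  have "{ennreal C | C. C > 0 \<and> (\<integral>\<^sup>+ \<omega>. ennreal (exp (\<bar>W \<omega>\<bar> powr \<alpha> / C powr \<alpha>)) \<partial>M) \<le> 2} \<noteq> {}"
    using assms unfolding psi_norm_def by (metis Inf_empty infinity_ennreal_def less_irrefl)
  then show ?thesis using that by blast
qed

text \<open>A square is at most twice the exponential: by the quadratic Taylor term for exponent 1
  (used for the norm of the regressor), by the linear one for exponent 2 (used for the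
  noise).\<close>

lemma (in prob_space) square_integrable_if_psi_norm_finite:
  assumes [measurable]: "W \<in> borel_measurable M" and "psi_norm M \<alpha> W < \<infinity>" and "\<alpha> = 1 \<or> \<alpha> = 2"
  shows "integrable M (\<lambda>\<omega>. (W \<omega>)\<^sup>2)"
proof -
  obtain C where C: "C > 0" "(\<integral>\<^sup>+ \<omega>. ennreal (exp (\<bar>W \<omega>\<bar> powr \<alpha> / C powr \<alpha>)) \<partial>M) \<le> 2"
    using assms(2) by (rule psi_norm_finiteE)
  have "integrable M (\<lambda>\<omega>. exp (\<bar>W \<omega>\<bar> powr \<alpha> / C powr \<alpha>))"
    using C(2) by (intro integrableI_bounded) (auto intro: le_less_trans)
  then have int: "integrable M (\<lambda>\<omega>. 2 * C\<^sup>2 * exp (\<bar>W \<omega>\<bar> powr \<alpha> / C powr \<alpha>))"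
    by simp
  show ?thesis
  proof (rule Bochner_Integration.integrable_bound[OF int])
    have "(W \<omega>)\<^sup>2 \<le> 2 * C\<^sup>2 * exp (\<bar>W \<omega>\<bar> powr \<alpha> / C powr \<alpha>)" for \<omega>
    proof -
      have "(W \<omega> / C)\<^sup>2 \<le> 2 * exp (\<bar>W \<omega>\<bar> powr \<alpha> / C powr \<alpha>)"
      proof (cases "\<alpha> = 1")
        case True
        have "1 + \<bar>W \<omega> / C\<bar> + \<bar>W \<omega> / C\<bar>\<^sup>2 / 2 \<le> exp \<bar>W \<omega> / C\<bar>"
          by (rule exp_lower_Taylor_quadratic) simp
        then have "(W \<omega> / C)\<^sup>2 \<le> 2 * exp \<bar>W \<omega> / C\<bar>"
          unfolding power2_abs using abs_ge_zero[of "W \<omega> / C"] by linarith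
        then show ?thesis using True C(1) by simp
      next
        case False
        with assms(3) have "\<alpha> = 2" by simp
        moreover have "1 + (W \<omega> / C)\<^sup>2 \<le> exp ((W \<omega> / C)\<^sup>2)" by (rule exp_ge_add_one_self)
        moreover have "0 \<le> exp ((W \<omega> / C)\<^sup>2)" by simp
        ultimately have "(W \<omega> / C)\<^sup>2 \<le> 2 * exp ((W \<omega> / C)\<^sup>2)" by linarith
        then show ?thesis using C(1) \<open>\<alpha> = 2\<close> by (simp add: power_divide)
      qed
      then show ?thesis using C(1) by (simp add: power_divide field_simps)
    qed
    then show "AE \<omega> in M. norm ((W \<omega>)\<^sup>2) \<le> norm (2 * C\<^sup>2 * exp (\<bar>W \<omega>\<bar> powr \<alpha> / C powr \<alpha>))"
      by simp
  qed simp
qed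

text \<open>With \<open>C\<close> admissible in the Orlicz norm, \<open>b\<close> is the square of
  \<open>C\<close>. For small t centring removes the linear term; for large t the square is
  completed and the factor 2 from the Orlicz condition is absorbed into the exponent.\<close>

lemma (in prob_space) sub_gaussian_mgf_bound:
  assumes [measurable]: "\<eta> \<in> borel_measurable M" and "psi_norm M 2 \<eta> < \<infinity>" and "expectation \<eta> = 0"
  obtains b where "b > 0" "\<And>t. (\<integral>\<^sup>+ \<omega>. ennreal (exp (t * \<eta> \<omega>)) \<partial>M) \<le> ennreal (exp (b * t\<^sup>2))"
proof -
  obtain C where C: "C > 0" "(\<integral>\<^sup>+ \<omega>. ennreal (exp (\<bar>\<eta> \<omega>\<bar> powr 2 / C powr 2)) \<partial>M) \<le> 2"
    using assms(2) by (rule psi_norm_finiteE)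
  define g where "g \<omega> = exp ((\<eta> \<omega>)\<^sup>2 / C\<^sup>2)" for \<omega>
  have [measurable]: "g \<in> borel_measurable M" unfolding g_def by measurable
  have g2: "(\<integral>\<^sup>+ \<omega>. ennreal (g \<omega>) \<partial>M) \<le> 2"
    using C by (simp add: g_def)
  have gi: "integrable M g"
    using g2 by (intro integrableI_bounded) (auto simp: g_def intro: le_less_trans)
  have Eg: "expectation g \<le> 2"
    using g2 by (subst (asm) nn_integral_eq_integral) (auto simp: gi g_def ennreal_le_iff simp flip: ennreal_numeral)
  have \<eta>i: "integrable M \<eta>"
    by (rule square_integrable_imp_integrable)
      (auto intro!: square_integrable_if_psi_norm_finite assms)
  have "(\<integral>\<^sup>+ \<omega>. ennreal (exp (t * \<eta> \<omega>)) \<partial>M) \<le> ennreal (exp (C\<^sup>2 * t\<^sup>2))" for t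
  proof (cases "C\<^sup>2 * t\<^sup>2 \<le> 1")
    case True
    define p where "p = C\<^sup>2 * t\<^sup>2"
    have p: "0 \<le> p" "p \<le> 1" using True by (auto simp: p_def)
    have "exp (t * \<eta> \<omega>) \<le> t * \<eta> \<omega> + ((1 - p) + p * g \<omega>)" for \<omega>
    proof -
      \<comment> \<open>Convexity of exp between 0 and
        \<open>(\<eta> \<omega>)\<^sup>2 / C\<^sup>2\<close> with weight \<open>p\<close> \<le> 1
        bounds the exponential of the square by an affine function of \<open>g\<close>, whose mean
        is at most 2. The total becomes 1 + p, hence at most exp p.\<close>
      have "convex_on UNIV (exp :: real \<Rightarrow> real)" by (rule exp_convex)
      then have "exp ((1 - p) *\<^sub>R 0 + p *\<^sub>R ((\<eta> \<omega>)\<^sup>2 / C\<^sup>2)) \<le> (1 - p) * exp 0 + p * exp ((\<eta> \<omega>)\<^sup>2 / C\<^sup>2)"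
        by (rule convex_onD) (use p in auto)
      moreover have "p * ((\<eta> \<omega>)\<^sup>2 / C\<^sup>2) = (t * \<eta> \<omega>)\<^sup>2"
        using C(1) by (simp add: p_def power_mult_distrib)
      ultimately show ?thesis
        using exp_le_add_exp_square[of "t * \<eta> \<omega>"] by (simp add: g_def)
    qed
    then have "(\<integral>\<^sup>+ \<omega>. ennreal (exp (t * \<eta> \<omega>)) \<partial>M) \<le> (\<integral>\<^sup>+ \<omega>. ennreal (t * \<eta> \<omega> + ((1 - p) + p * g \<omega>)) \<partial>M)"
      by (intro nn_integral_mono ennreal_leI)
    also have "\<dots> = ennreal (\<integral>\<omega>. t * \<eta> \<omega> + ((1 - p) + p * g \<omega>) \<partial>M)"
      using \<open>\<And>\<omega>. exp (t * \<eta> \<omega>) \<le> t * \<eta> \<omega> + ((1 - p) + p * g \<omega>)\<close>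
      by (intro nn_integral_eq_integral) (auto simp: \<eta>i gi intro: order_trans[OF exp_ge_zero])
    also have "(\<integral>\<omega>. t * \<eta> \<omega> + ((1 - p) + p * g \<omega>) \<partial>M) = (1 - p) + p * expectation g"
      using \<eta>i gi assms(3) by (simp add: prob_space)
    also have "ennreal \<dots> \<le> ennreal (exp (C\<^sup>2 * t\<^sup>2))"
    proof (rule ennreal_leI)
      have "p * expectation g \<le> p * 2" using Eg p by (intro mult_left_mono) auto
      then show "(1 - p) + p * expectation g \<le> exp (C\<^sup>2 * t\<^sup>2)"
        using exp_ge_add_one_self[of p] unfolding p_def[symmetric] by linarith
    qed
    finally show ?thesis .
  next
    case False
    have "exp (t * \<eta> \<omega>) \<le> exp (C\<^sup>2 * t\<^sup>2 / 4) * g \<omega>" for \<omega>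
    proof -
      \<comment> \<open>Completing the square spends only a quarter of the available exponent
        \<open>C\<^sup>2 * t\<^sup>2\<close>.\<close>
      have "0 \<le> (C * t / 2 - \<eta> \<omega> / C)\<^sup>2" by simp
      also have "\<dots> = C\<^sup>2 * t\<^sup>2 / 4 + (\<eta> \<omega>)\<^sup>2 / C\<^sup>2 - t * \<eta> \<omega>"
        using C(1) by (simp add: power2_eq_square field_simps)
      finally show ?thesis by (simp add: g_def flip: exp_add)
    qed
    then have "(\<integral>\<^sup>+ \<omega>. ennreal (exp (t * \<eta> \<omega>)) \<partial>M) \<le> (\<integral>\<^sup>+ \<omega>. ennreal (exp (C\<^sup>2 * t\<^sup>2 / 4)) * ennreal (g \<omega>) \<partial>M)"
      by (intro nn_integral_mono) (simp add: g_def ennreal_leI flip: ennreal_mult)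
    also have "\<dots> = ennreal (exp (C\<^sup>2 * t\<^sup>2 / 4)) * (\<integral>\<^sup>+ \<omega>. ennreal (g \<omega>) \<partial>M)"
      by (rule nn_integral_cmult) measurable
    also have "\<dots> \<le> ennreal (exp (C\<^sup>2 * t\<^sup>2 / 4)) * ennreal 2"
      using g2 by (intro mult_left_mono) auto
    also have "\<dots> = ennreal (exp (C\<^sup>2 * t\<^sup>2 / 4) * 2)" by (subst ennreal_mult) auto
    also have "\<dots> \<le> ennreal (exp (C\<^sup>2 * t\<^sup>2))"
    proof (rule ennreal_leI)
      \<comment> \<open>The remaining three quarters of the exponent exceed 3/4 in this case, which
        pays for the factor 2.\<close>
      have "(2::real) \<le> exp (3/4)"
        using exp_lower_Taylor_quadratic[of "3/4::real"] by (simp add: power2_eq_square)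
      also have "\<dots> \<le> exp (3 * (C\<^sup>2 * t\<^sup>2) / 4)" using False by simp
      finally have "exp (C\<^sup>2 * t\<^sup>2 / 4) * 2 \<le> exp (C\<^sup>2 * t\<^sup>2 / 4) * exp (3 * (C\<^sup>2 * t\<^sup>2) / 4)"
        by (intro mult_left_mono) auto
      then show "exp (C\<^sup>2 * t\<^sup>2 / 4) * 2 \<le> exp (C\<^sup>2 * t\<^sup>2)"
        by (simp flip: exp_add)
    qed
    finally show ?thesis .
  qed
  then show ?thesis using C(1) by (intro that[of "C\<^sup>2"]) auto
qed

text \<open>A sequence of independent pairs is a pair of independent sequences. This permits fixing
  the whole design and integrating over the noise alone. The proof peels off one index at a time and
  reorders the integrals by Fubini.\<close>

lemma nn_integral_PiM_pair_measure:
  fixes D1 :: "'a measure" and D2 :: "'b measure" and F :: "('i \<Rightarrow> 'a \<times> 'b) \<Rightarrow> ennreal"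
  assumes "prob_space D1" "prob_space D2" "finite I"
    and "F \<in> borel_measurable (PiM I (\<lambda>_. D1 \<Otimes>\<^sub>M D2))"
  shows "(\<integral>\<^sup>+ w. F w \<partial>PiM I (\<lambda>_. D1 \<Otimes>\<^sub>M D2)) =
    (\<integral>\<^sup>+ z. (\<integral>\<^sup>+ e. F (\<lambda>i\<in>I. (z i, e i)) \<partial>PiM I (\<lambda>_. D2)) \<partial>PiM I (\<lambda>_. D1))"
  using assms(3,4)
proof (induction I arbitrary: F rule: finite_induct)
  case empty
  show ?case by (simp add: space_PiM PiM_empty nn_integral_count_space_finite restrict_def)
next
  case (insert j I)
  interpret D1: prob_space D1 by fact
  interpret D2: prob_space D2 by fact
  interpret D: pair_prob_space D1 D2 ..
  interpret p1: product_prob_space "\<lambda>_. D1" I ..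
  interpret p2: product_prob_space "\<lambda>_. D2" I ..
  interpret p: product_prob_space "\<lambda>_. D1 \<Otimes>\<^sub>M D2" I ..
  interpret q1: prob_space "PiM I (\<lambda>_. D1)" by (rule prob_space_PiM) (rule assms)
  interpret q2: prob_space "PiM I (\<lambda>_. D2)" by (rule prob_space_PiM) (rule assms)
  interpret s: pair_sigma_finite D1 "PiM I (\<lambda>_. D2)" ..
  note insert.prems[measurable]
  have m1: "(\<lambda>w. \<integral>\<^sup>+ y. F (w(j := y)) \<partial>(D1 \<Otimes>\<^sub>M D2)) \<in> borel_measurable (PiM I (\<lambda>_. D1 \<Otimes>\<^sub>M D2))"
    by measurable
  define G where "G z e = F (\<lambda>i\<in>insert j I. (z i, e i))" for z e
  have G [measurable]: "case_prod G \<in> borel_measurable (PiM (insert j I) (\<lambda>_. D1) \<Otimes>\<^sub>M PiM (insert j I) (\<lambda>_. D2))"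
    unfolding G_def case_prod_beta'
    by (rule measurable_compose[OF _ insert.prems], rule measurable_restrict) measurable
  have eq: "F ((\<lambda>i\<in>I. (z i, e i))(j := (y1, y2))) = G (z(j := y1)) (e(j := y2))"
    for z :: "'i \<Rightarrow> 'a" and e :: "'i \<Rightarrow> 'b" and y1 y2
    unfolding G_def using insert.hyps by (intro arg_cong[of _ _ F]) (auto simp: fun_eq_iff restrict_def)
  have zip: "(\<lambda>i\<in>I. (z i, e i)) \<in> space (PiM I (\<lambda>_. D1 \<Otimes>\<^sub>M D2))"
    if "z \<in> space (PiM I (\<lambda>_. D1))" "e \<in> space (PiM I (\<lambda>_. D2))" for z e
    using that by (auto simp: space_PiM space_pair_measure)
  have "(\<integral>\<^sup>+ w. F w \<partial>PiM (insert j I) (\<lambda>_. D1 \<Otimes>\<^sub>M D2)) =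
      (\<integral>\<^sup>+ w. (\<integral>\<^sup>+ y. F (w(j := y)) \<partial>(D1 \<Otimes>\<^sub>M D2)) \<partial>PiM I (\<lambda>_. D1 \<Otimes>\<^sub>M D2))"
    by (rule p.product_nn_integral_insert) (use insert in auto)
  also have "\<dots> = (\<integral>\<^sup>+ z. (\<integral>\<^sup>+ e. (\<integral>\<^sup>+ y. F ((\<lambda>i\<in>I. (z i, e i))(j := y)) \<partial>(D1 \<Otimes>\<^sub>M D2)) \<partial>PiM I (\<lambda>_. D2)) \<partial>PiM I (\<lambda>_. D1))"
    by (rule insert.IH[OF m1])
  also have "\<dots> = (\<integral>\<^sup>+ z. (\<integral>\<^sup>+ e. (\<integral>\<^sup>+ y1. (\<integral>\<^sup>+ y2. G (z(j := y1)) (e(j := y2)) \<partial>D2) \<partial>D1) \<partial>PiM I (\<lambda>_. D2)) \<partial>PiM I (\<lambda>_. D1))"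
    unfolding eq[symmetric]
    by (intro nn_integral_cong D2.nn_integral_fst[symmetric]
        measurable_compose[OF measurable_component_update insert.prems] zip insert.hyps)
  \<comment> \<open>The first component at the new index is moved outside the noise of the old
    indices, so that each of the two updates at \<open>j\<close> stands next to the product it
    extends.\<close>
  also have "\<dots> = (\<integral>\<^sup>+ z. (\<integral>\<^sup>+ y1. (\<integral>\<^sup>+ e. (\<integral>\<^sup>+ y2. G (z(j := y1)) (e(j := y2)) \<partial>D2) \<partial>PiM I (\<lambda>_. D2)) \<partial>D1) \<partial>PiM I (\<lambda>_. D1))"
  proof (intro nn_integral_cong s.Fubini')
    fix z assume [measurable]: "z \<in> space (PiM I (\<lambda>_. D1))"
    have "(\<lambda>(y1, e). \<integral>\<^sup>+ y2. G (z(j := y1)) (e(j := y2)) \<partial>D2)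
      \<in> borel_measurable (D1 \<Otimes>\<^sub>M PiM I (\<lambda>_. D2))"
      using insert.hyps by measurable
    then show "(\<lambda>(y1, e). \<integral>\<^sup>+ y2. G (z(j := y1)) (e(j := y2)) \<partial>D2)
      \<in> borel_measurable (D1 \<Otimes>\<^sub>M PiM I (\<lambda>_. D2))" .
  qed
  also have "\<dots> = (\<integral>\<^sup>+ z. (\<integral>\<^sup>+ y1. (\<integral>\<^sup>+ e. G (z(j := y1)) e \<partial>PiM (insert j I) (\<lambda>_. D2)) \<partial>D1) \<partial>PiM I (\<lambda>_. D1))"
  proof (intro nn_integral_cong p2.product_nn_integral_insert[symmetric] insert.hyps)
    fix z y1 assume "z \<in> space (PiM I (\<lambda>_. D1))" "y1 \<in> space D1"
    then have "z(j := y1) \<in> space (PiM (insert j I) (\<lambda>_. D1))"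
      by (auto simp: space_PiM PiE_iff extensional_def)
    then show "G (z(j := y1)) \<in> borel_measurable (PiM (insert j I) (\<lambda>_. D2))"
      using measurable_Pair2[OF G] by simp
  qed
  also have "\<dots> = (\<integral>\<^sup>+ z. (\<integral>\<^sup>+ e. G z e \<partial>PiM (insert j I) (\<lambda>_. D2)) \<partial>PiM (insert j I) (\<lambda>_. D1))"
  proof (rule p1.product_nn_integral_insert[symmetric])
    interpret q3: prob_space "PiM (insert j I) (\<lambda>_. D2)" by (rule prob_space_PiM) (rule assms)
    show "(\<lambda>z. \<integral>\<^sup>+ e. G z e \<partial>PiM (insert j I) (\<lambda>_. D2))
        \<in> borel_measurable (PiM (insert j I) (\<lambda>_. D1))"
      by measurable
  qed (use insert in auto)
  finally show ?case unfolding G_def .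
qed

section \<open>Matrices and least squares\<close>

lemma borel_measurable_vec:
  fixes f :: "'a \<Rightarrow> 'b::euclidean_space ^ 'n"
  assumes "\<And>i. (\<lambda>x. f x $ i) \<in> borel_measurable M"
  shows "f \<in> borel_measurable M"
proof (subst borel_measurable_euclidean_space, intro ballI)
  fix b :: "'b ^ 'n" assume "b \<in> Basis"
  then obtain i u where b: "b = axis i u" by (auto simp: Basis_vec_def)
  have "(\<lambda>x. f x $ i \<bullet> u) \<in> borel_measurable M"
    using assms[of i] by measurable
  then show "(\<lambda>x. f x \<bullet> b) \<in> borel_measurable M"
    by (simp add: b inner_axis)
qed

lemma borel_measurable_vec_nth [measurable (raw)]:
  fixes f :: "'a \<Rightarrow> 'b::euclidean_space ^ 'n"
  assumes "f \<in> borel_measurable M"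
  shows "(\<lambda>x. f x $ i) \<in> borel_measurable M"
  using borel_measurable_continuous_onI[of "\<lambda>v :: 'b ^ 'n. v $ i"] assms
  by (rule measurable_compose_rev) (intro continuous_intros)

lemma borel_measurable_det [measurable (raw)]:
  fixes f :: "'a \<Rightarrow> real ^ 'n ^ 'n"
  assumes [measurable]: "f \<in> borel_measurable M"
  shows "(\<lambda>x. det (f x)) \<in> borel_measurable M"
  unfolding det_def by measurable

lemma matrix_inv_mult:
  fixes A :: "real ^ 'n ^ 'n"
  assumes "invertible A"
  shows "matrix_inv A ** A = mat 1" "A ** matrix_inv A = mat 1"
  using someI_ex[OF assms[unfolded invertible_def]] by (auto simp: matrix_inv_def)

text \<open>Cramer's rule writes the entries as quotients of determinants where the determinant is
  nonzero; on singular matrices the inverse takes a single default value, so the case distinction is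
  measurable.\<close>

lemma borel_measurable_matrix_inv [measurable (raw)]:
  fixes f :: "'a \<Rightarrow> real ^ 'n ^ 'n"
  assumes [measurable]: "f \<in> borel_measurable M"
  shows "(\<lambda>x. matrix_inv (f x)) \<in> borel_measurable M"
proof -
  \<comment> \<open>Column \<open>k\<close> is replaced by the unit vector in direction
    \<open>l\<close>, the numerator in Cramer's rule.\<close>
  define B where "B A k l = (\<chi> i j. if j = k then axis l 1 $ i else A $ i $ j)" for A :: "real ^ 'n ^ 'n" and k l :: 'n
  define U :: "real ^ 'n ^ 'n" where "U = (SOME _. False)"
  \<comment> \<open>For a singular matrix the predicate under the choice operator is constantly
    false, so the chosen matrix does not depend on \<open>A\<close>.\<close>
  have U: "matrix_inv A = U" if "det A = 0" for A :: "real ^ 'n ^ 'n"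
  proof -
    have "\<not> invertible A" using that by (simp add: invertible_det_nz)
    then show ?thesis unfolding matrix_inv_def U_def invertible_def by (intro arg_cong[where f = Eps]) auto
  qed
  have inv: "matrix_inv A $ k $ l = (if det A = 0 then U $ k $ l else det (B A k l) / det A)" for A k l
  proof (cases "det A = 0")
    case False
    then have "A *v (matrix_inv A *v axis l 1) = axis l 1"
      by (simp add: invertible_det_nz matrix_inv_mult matrix_vector_mul_assoc)
    then have "matrix_inv A *v axis l 1 = (\<chi> k. det (B A k l) / det A)"
      using False by (subst (asm) cramer) (auto simp: B_def)
    then have "(matrix_inv A *v axis l 1) $ k = det (B A k l) / det A"
      by simp
    then show ?thesis using False by (simp add: matrix_vector_mul_component inner_axis)
  qed (simp add: U)
  have [measurable]: "(\<lambda>x. B (f x) k l) \<in> borel_measurable M" for k l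
    unfolding B_def by (intro borel_measurable_vec) (simp, measurable)
  show ?thesis
    by (intro borel_measurable_vec) (simp add: inv)
qed

section \<open>Gram matrices and ordinary least squares under a spectral lower bound\<close>

lemma inner_gram_mult: "y \<bullet> (gram m Z *v y) = (\<Sum>l = 1..m. (Z l \<bullet> y)\<^sup>2)"
proof -
  have "y \<bullet> (gram m Z *v y) = (\<Sum>i\<in>UNIV. \<Sum>j\<in>UNIV. \<Sum>l = 1..m. (Z l $ i * y $ i) * (Z l $ j * y $ j))"
    by (simp add: inner_vec_def matrix_vector_mult_def gram_def sum_distrib_left sum_distrib_right mult_ac)
  also have "\<dots> = (\<Sum>i\<in>UNIV. \<Sum>l = 1..m. \<Sum>j\<in>UNIV. (Z l $ i * y $ i) * (Z l $ j * y $ j))"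
    by (intro sum.cong refl sum.swap)
  also have "\<dots> = (\<Sum>l = 1..m. \<Sum>i\<in>UNIV. \<Sum>j\<in>UNIV. (Z l $ i * y $ i) * (Z l $ j * y $ j))"
    by (rule sum.swap)
  also have "\<dots> = (\<Sum>l = 1..m. (Z l \<bullet> y)\<^sup>2)"
    by (simp add: inner_vec_def power2_eq_square sum_product)
  finally show ?thesis .
qed

lemma transpose_gram: "transpose (gram m Z) = gram m Z"
  by (simp add: transpose_def gram_def vec_eq_iff mult.commute)

context
  fixes Z :: "nat \<Rightarrow> real ^ 'd" and m :: nat and \<kappa> :: real
  assumes coercive: "\<And>y. \<kappa> * (norm y)\<^sup>2 \<le> (\<Sum>l = 1..m. (Z l \<bullet> y)\<^sup>2)" and kappa_pos: "\<kappa> > 0"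
begin

lemma invertible_gram: "invertible (gram m Z)"
proof -
  have "y = 0" if "gram m Z *v y = 0" for y
  proof -
    have "\<kappa> * (norm y)\<^sup>2 \<le> 0"
      using coercive[of y] unfolding inner_gram_mult[symmetric] that by simp
    then show ?thesis using kappa_pos by (simp add: mult_le_0_iff)
  qed
  then show ?thesis
    unfolding invertible_left_inverse matrix_left_invertible_ker by blast
qed

text \<open>The Gram matrix is symmetric, so the transpose of its inverse is again an inverse, and
  inverses are unique.\<close>

lemma transpose_inv_gram: "transpose (matrix_inv (gram m Z)) = matrix_inv (gram m Z)"
proof -
  let ?G = "gram m Z" and ?B = "matrix_inv (gram m Z)"
  have "transpose (?B ** ?G) = mat 1"
    using matrix_inv_mult[OF invertible_gram] by (simp add: transpose_mat)
  then have *: "?G ** transpose ?B = mat 1"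
    by (simp add: matrix_transpose_mul transpose_gram)
  have "transpose ?B = ?B ** ?G ** transpose ?B"
    using matrix_inv_mult[OF invertible_gram] by simp
  also have "\<dots> = ?B" using * by (simp flip: matrix_mul_assoc)
  finally show ?thesis .
qed

text \<open>Symmetry of the inverse moves it onto the unit vector. The weights of coefficient
  \<open>j\<close> are thus the inner products of the rows with one fixed vector, and their squares
  add up to a Gram quadratic form.\<close>

lemma pinv_col_nth: "pinv_col m Z l $ j = Z l \<bullet> (matrix_inv (gram m Z) *v axis j 1)"
proof -
  let ?B = "matrix_inv (gram m Z)"
  have "pinv_col m Z l $ j = axis j 1 \<bullet> (?B *v Z l)"
    by (simp add: pinv_col_def inner_axis')
  also have "\<dots> = (axis j 1 v* ?B) \<bullet> Z l"
    by (simp add: dot_lmul_matrix)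
  also have "axis j 1 v* ?B = ?B *v axis j 1"
    by (metis transpose_inv_gram transpose_matrix_vector)
  finally show ?thesis by (simp add: inner_commute)
qed

text \<open>For y the j-th column of the inverse, the quadratic form at y equals the diagonal entry
  y_j. Coercivity gives \<kappa> y_j^2 \<le> \<kappa> |y|^2 \<le> y_j, and division by y_j, if
  positive, leaves 1/\<kappa>. This sum is the variance proxy of the noise in coefficient
  \<open>j\<close>.\<close>

lemma sum_pinv_col_square_le: "(\<Sum>l = 1..m. (pinv_col m Z l $ j)\<^sup>2) \<le> 1 / \<kappa>"
proof -
  define y where "y = matrix_inv (gram m Z) *v axis j 1"
  have "gram m Z *v y = axis j 1"
    by (simp add: y_def matrix_vector_mul_assoc matrix_inv_mult[OF invertible_gram])
  then have sum: "(\<Sum>l = 1..m. (Z l \<bullet> y)\<^sup>2) = y $ j"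
    unfolding inner_gram_mult[symmetric] by (simp add: inner_axis)
  have "(y $ j)\<^sup>2 \<le> (norm y)\<^sup>2"
    using component_le_norm_cart[of y j] by (metis abs_ge_zero power2_abs power_mono)
  then have "\<kappa> * (y $ j)\<^sup>2 \<le> \<kappa> * (norm y)\<^sup>2" using kappa_pos by simp
  also have "\<dots> \<le> y $ j" using coercive[of y] sum by simp
  finally have "\<kappa> * (y $ j)\<^sup>2 \<le> y $ j" .
  then have "y $ j \<le> 1 / \<kappa>"
    using kappa_pos
    by (cases "y $ j > 0") (auto simp: power2_eq_square field_simps mult_nonneg_nonpos intro: order_trans[of _ 0])
  then show ?thesis unfolding pinv_col_nth y_def[symmetric] sum .
qed

text \<open>Least squares reproduces an exactly linear response, since the inverse cancels the Gram
  matrix; hence only the residuals survive in the error.\<close>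

lemma ols_error:
  "ols m Z F - \<beta> = (\<chi> a j. \<Sum>l = 1..m. (F l - \<beta> *v Z l) $ a * pinv_col m Z l $ j)"
proof -
  have "(\<Sum>l = 1..m. (\<beta> *v Z l) $ a * pinv_col m Z l $ j) = \<beta> $ a $ j" for a j
  proof -
    define B where "B = matrix_inv (gram m Z)"
    have "(\<Sum>l = 1..m. (\<beta> *v Z l) $ a * pinv_col m Z l $ j)
        = (\<Sum>l = 1..m. \<Sum>i\<in>UNIV. \<Sum>k\<in>UNIV. \<beta> $ a $ i * (B $ j $ k * (Z l $ k * Z l $ i)))"
      by (simp add: matrix_vector_mult_def pinv_col_def B_def sum_product mult_ac)
    also have "\<dots> = (\<Sum>i\<in>UNIV. \<Sum>l = 1..m. \<Sum>k\<in>UNIV. \<beta> $ a $ i * (B $ j $ k * (Z l $ k * Z l $ i)))"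
      by (rule sum.swap)
    also have "\<dots> = (\<Sum>i\<in>UNIV. \<Sum>k\<in>UNIV. \<Sum>l = 1..m. \<beta> $ a $ i * (B $ j $ k * (Z l $ k * Z l $ i)))"
      by (intro sum.cong refl sum.swap)
    also have "\<dots> = (\<Sum>i\<in>UNIV. \<beta> $ a $ i * (B ** gram m Z) $ j $ i)"
      by (simp add: matrix_matrix_mult_def gram_def sum_distrib_left)
    also have "B ** gram m Z = mat 1"
      unfolding B_def by (rule matrix_inv_mult[OF invertible_gram])
    also have "(\<Sum>i\<in>UNIV. \<beta> $ a $ i * (mat 1 :: real ^ 'd ^ 'd) $ j $ i) = \<beta> $ a $ j"
      by (simp add: mat_def if_distrib cong: if_cong)
    finally show ?thesis .
  qed
  then show ?thesis
    by (simp add: vec_eq_iff ols_def left_diff_distrib sum_subtractf)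
qed

end

section \<open>The norm of the matrix type as the Frobenius norm\<close>

lemma norm_matrix_vector_mult_le:
  fixes A :: "real ^ 'n ^ 'm"
  shows "(norm (A *v x))\<^sup>2 \<le> (norm A)\<^sup>2 * (norm x)\<^sup>2"
proof -
  have "(norm (A *v x))\<^sup>2 = (\<Sum>i\<in>UNIV. (A $ i \<bullet> x)\<^sup>2)"
    by (simp add: norm_vec_def L2_set_def sum_nonneg matrix_vector_mul_component)
  also have "\<dots> \<le> (\<Sum>i\<in>UNIV. (norm (A $ i))\<^sup>2 * (norm x)\<^sup>2)"
    by (intro sum_mono) (metis Cauchy_Schwarz_ineq2 abs_ge_zero power2_abs power_mono power_mult_distrib)
  also have "\<dots> = (norm A)\<^sup>2 * (norm x)\<^sup>2"
    by (simp add: norm_vec_def[of A] L2_set_def sum_nonneg sum_distrib_right)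
  finally show ?thesis .
qed

text \<open>Each row of the product is the transpose of \<open>B\<close> applied to a row of
  \<open>A\<close>, and the Frobenius norm is invariant under transposition.\<close>

lemma norm_matrix_mult_le:
  fixes A :: "real ^ 'n ^ 'm" and B :: "real ^ 'k ^ 'n"
  shows "(norm (A ** B))\<^sup>2 \<le> (norm A)\<^sup>2 * (norm B)\<^sup>2"
proof -
  have sq: "(norm C)\<^sup>2 = (\<Sum>i\<in>UNIV. (norm (C $ i))\<^sup>2)" for C :: "real ^ 'p ^ 'q"
    by (simp add: norm_vec_def[of C] L2_set_def sum_nonneg)
  have row: "(A ** B) $ i = transpose B *v (A $ i)" for i
    by (simp add: vec_eq_iff matrix_matrix_mult_def matrix_vector_mult_def transpose_def mult.commute)
  have tr: "norm (transpose B) = norm B"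
  proof -
    have "(norm (transpose B))\<^sup>2 = (norm B)\<^sup>2"
      unfolding sq by (simp add: norm_vec_def L2_set_def sum_nonneg transpose_def) (rule sum.swap)
    then show ?thesis by (simp add: power2_eq_iff_nonneg)
  qed
  have "(norm (A ** B))\<^sup>2 \<le> (\<Sum>i\<in>UNIV. (norm B)\<^sup>2 * (norm (A $ i))\<^sup>2)"
    unfolding sq[of "A ** B"] row by (intro sum_mono) (metis norm_matrix_vector_mult_le tr)
  then show ?thesis by (simp add: sq[of A] sum_distrib_left mult.commute)
qed

section \<open>Second moment matrices\<close>

lemma inner_second_moment:
  fixes Z :: "'a \<Rightarrow> real ^ 'd"
  assumes "\<And>i j. integrable M (\<lambda>\<omega>. Z \<omega> $ i * Z \<omega> $ j)"
  shows "x \<bullet> (second_moment_matrix M Z *v y) = (\<integral>\<omega>. (Z \<omega> \<bullet> x) * (Z \<omega> \<bullet> y) \<partial>M)"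
proof -
  have "(\<integral>\<omega>. (Z \<omega> \<bullet> x) * (Z \<omega> \<bullet> y) \<partial>M) =
      (\<integral>\<omega>. (\<Sum>i\<in>UNIV. \<Sum>j\<in>UNIV. (x $ i * y $ j) * (Z \<omega> $ i * Z \<omega> $ j)) \<partial>M)"
    by (simp add: inner_vec_def sum_product mult_ac)
  also have "\<dots> = (\<Sum>i\<in>UNIV. \<Sum>j\<in>UNIV. (x $ i * y $ j) * (\<integral>\<omega>. Z \<omega> $ i * Z \<omega> $ j \<partial>M))"
    using assms by simp
  also have "\<dots> = x \<bullet> (second_moment_matrix M Z *v y)"
    by (simp add: inner_vec_def matrix_vector_mult_def second_moment_matrix_def sum_distrib_left mult_ac)
  finally show ?thesis ..
qed

lemma integrable_mult_components:
  fixes Z :: "'a \<Rightarrow> real ^ 'd"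
  assumes [measurable]: "Z \<in> borel_measurable M" and int: "integrable M (\<lambda>\<omega>. (norm (Z \<omega>))\<^sup>2)"
  shows "integrable M (\<lambda>\<omega>. Z \<omega> $ i * Z \<omega> $ j)"
proof (rule Bochner_Integration.integrable_bound[OF int])
  have "\<bar>z $ i * z $ j\<bar> \<le> (norm z)\<^sup>2" for z :: "real ^ 'd"
    unfolding abs_mult power2_eq_square
    by (intro mult_mono component_le_norm_cart) auto
  then show "AE \<omega> in M. norm (Z \<omega> $ i * Z \<omega> $ j) \<le> norm ((norm (Z \<omega>))\<^sup>2)"
    by simp
qed simp

lemma integrable_inner_mult:
  fixes Z :: "'a \<Rightarrow> real ^ 'd"
  assumes "Z \<in> borel_measurable M" and "integrable M (\<lambda>\<omega>. (norm (Z \<omega>))\<^sup>2)"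
  shows "integrable M (\<lambda>\<omega>. (Z \<omega> \<bullet> x) * (Z \<omega> \<bullet> y))"
proof -
  have "(z \<bullet> x) * (z \<bullet> y) = (\<Sum>i\<in>UNIV. \<Sum>j\<in>UNIV. (x $ i * y $ j) * (z $ i * z $ j))" for z
    by (simp add: inner_vec_def sum_product mult_ac)
  then show ?thesis
    using integrable_mult_components[OF assms] by simp
qed

text \<open>The quadratic form attains its minimum on the compact unit sphere, and homogeneity
  extends the bound to all vectors. A zero minimum would put a unit vector in the kernel of an
  invertible matrix.\<close>

lemma (in prob_space) second_moment_coercive:
  fixes Z :: "'a \<Rightarrow> real ^ 'd"
  assumes [measurable]: "Z \<in> borel_measurable M" and int: "integrable M (\<lambda>\<omega>. (norm (Z \<omega>))\<^sup>2)"
    and inv: "invertible (second_moment_matrix M Z)"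
  obtains c where "c > 0" "\<And>y. c * (norm y)\<^sup>2 \<le> expectation (\<lambda>\<omega>. (Z \<omega> \<bullet> y)\<^sup>2)"
proof -
  let ?L = "second_moment_matrix M Z"
  define q where "q y = y \<bullet> (?L *v y)" for y
  note ints = integrable_mult_components[OF assms(1,2)] integrable_inner_mult[OF assms(1,2)]
  have q: "q y = expectation (\<lambda>\<omega>. (Z \<omega> \<bullet> y)\<^sup>2)" for y
    unfolding q_def by (subst inner_second_moment) (auto simp: ints power2_eq_square)
  have "continuous_on (sphere 0 1) q"
    unfolding q_def by (intro continuous_intros)
  moreover have "sphere 0 1 \<noteq> ({} :: (real ^ 'd) set)"
    using norm_axis_1 by (metis empty_iff mem_sphere_0)
  ultimately obtain y0 where y0: "norm y0 = 1" "\<And>y. norm y = 1 \<Longrightarrow> q y0 \<le> q y"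
    using continuous_attains_inf[OF compact_sphere, of 0 1 q] by auto
  have "q y0 \<noteq> 0"
  proof
    assume "q y0 = 0"
    then have "AE \<omega> in M. (Z \<omega> \<bullet> y0)\<^sup>2 = 0"
      using integral_nonneg_eq_0_iff_AE[of M "\<lambda>\<omega>. (Z \<omega> \<bullet> y0)\<^sup>2"] ints(2)[of y0 y0] by (simp add: q power2_eq_square)
    \<comment> \<open>Since \<open>Z \<omega> \<bullet> y0\<close> vanishes almost everywhere, so do
      all its mixed moments; testing against every x places \<open>y0\<close> in the kernel.\<close>
    then have "x \<bullet> (?L *v y0) = 0" for x
      by (subst inner_second_moment[OF ints(1)]) (auto intro!: integral_eq_zero_AE)
    then have "?L *v y0 = 0" by (metis inner_eq_zero_iff)
    then have "y0 = 0"
      using inv unfolding invertible_left_inverse matrix_left_invertible_ker by blast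
    then show False using y0(1) by simp
  qed
  moreover have "q y0 \<ge> 0" by (simp add: q)
  moreover have "q y0 * (norm y)\<^sup>2 \<le> q y" for y
  proof (cases "y = 0")
    case False
    have "q y0 \<le> q (y /\<^sub>R norm y)" using False by (intro y0) simp
    also have "\<dots> = q y / (norm y)\<^sup>2"
      by (simp add: q_def matrix_vector_mult_scaleR power2_eq_square field_simps)
    finally show ?thesis using False by (simp add: field_simps)
  qed (simp add: q_def)
  ultimately show ?thesis
    using that[of "q y0"] unfolding q[symmetric] by (simp add: order_le_less)
qed

text \<open>Entries of the outer product of z with itself, with the whole vector discarded when its
  norm exceeds \<open>R\<close>. Truncating by the norm, not entry by entry, keeps the quadratic
  form equal to a square or to zero, while every entry becomes bounded.\<close>

definition trunc_prod :: "real \<Rightarrow> 'd \<Rightarrow> 'd \<Rightarrow> real ^ 'd \<Rightarrow> real" where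
  "trunc_prod R i j z = (if norm z \<le> R then z $ i * z $ j else 0)"

lemma borel_measurable_trunc_prod [measurable]: "trunc_prod R i j \<in> borel_measurable borel"
proof -
  have [measurable]: "(\<lambda>z :: real ^ 'd. z $ k) \<in> borel_measurable borel" for k
    by (rule borel_measurable_vec_nth) simp
  show ?thesis unfolding trunc_prod_def[abs_def] by measurable
qed

lemma abs_trunc_prod_le: "\<bar>trunc_prod R i j z\<bar> \<le> R\<^sup>2"
proof -
  have "\<bar>z $ i * z $ j\<bar> \<le> R\<^sup>2" if "norm z \<le> R"
    unfolding abs_mult power2_eq_square
    by (intro mult_mono order_trans[OF component_le_norm_cart that]) (use that norm_ge_zero[of z] in linarith)+
  then show ?thesis by (auto simp: trunc_prod_def)
qed

lemma sum_trunc_prod: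
  "(\<Sum>i\<in>UNIV. \<Sum>j\<in>UNIV. (y $ i * y $ j) * trunc_prod R i j z) = (if norm z \<le> R then (z \<bullet> y)\<^sup>2 else 0)"
  by (simp add: trunc_prod_def inner_vec_def power2_eq_square sum_product mult_ac)

text \<open>The second moment carried by large norms tends to zero as the truncation level grows, so
  some level costs at most half of the coercivity constant.\<close>

lemma (in prob_space) truncated_second_moment_coercive:
  fixes Z :: "'a \<Rightarrow> real ^ 'd"
  assumes [measurable]: "Z \<in> borel_measurable M" and int: "integrable M (\<lambda>\<omega>. (norm (Z \<omega>))\<^sup>2)"
    and inv: "invertible (second_moment_matrix M Z)"
  obtains c R where "c > 0" "R > 0"
    "\<And>y. c * (norm y)\<^sup>2 \<le> (\<Sum>i\<in>UNIV. \<Sum>j\<in>UNIV. (y $ i * y $ j) * expectation (\<lambda>\<omega>. trunc_prod R i j (Z \<omega>)))"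
proof -
  obtain c where c: "c > 0" "\<And>y. c * (norm y)\<^sup>2 \<le> expectation (\<lambda>\<omega>. (Z \<omega> \<bullet> y)\<^sup>2)"
    using second_moment_coercive[OF assms] by blast
  \<comment> \<open>The mass lost by truncation at level \<open>R\<close>; dominated convergence
    along integer levels makes its mean smaller than \<open>c / 2\<close>.\<close>
  define T where "T R \<omega> = (if norm (Z \<omega>) \<le> R then 0 else (norm (Z \<omega>))\<^sup>2)" for R \<omega>
  have [measurable]: "T R \<in> borel_measurable M" for R unfolding T_def by measurable
  have "(\<lambda>n. expectation (T (real n))) \<longlonglongrightarrow> expectation (\<lambda>_. 0)"
  proof (rule integral_dominated_convergence[where w = "\<lambda>\<omega>. (norm (Z \<omega>))\<^sup>2"])
    show "AE \<omega> in M. (\<lambda>n. T (real n) \<omega>) \<longlonglongrightarrow> 0"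
    proof (rule AE_I2)
      fix \<omega>
      have "\<forall>\<^sub>F n in sequentially. norm (Z \<omega>) \<le> real n"
        using filterlim_real_sequentially by (simp add: filterlim_at_top)
      then have "\<forall>\<^sub>F n in sequentially. T (real n) \<omega> = 0"
        by eventually_elim (simp add: T_def)
      then show "(\<lambda>n. T (real n) \<omega>) \<longlonglongrightarrow> 0" by (rule tendsto_eventually)
    qed
  qed (auto simp: int T_def)
  then have "\<forall>\<^sub>F n in sequentially. expectation (T (real n)) < c / 2"
    using c(1) by (intro order_tendstoD) auto
  then have "\<forall>\<^sub>F n in sequentially. expectation (T (real n)) < c / 2 \<and> n > 0"
    using eventually_gt_at_top by (rule eventually_conj)
  then obtain n :: nat where n: "expectation (T (real n)) < c / 2" "n > 0"
    by (auto dest: eventually_happens)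
  define R where "R = real n"
  have Ti: "integrable M (T R)"
    by (rule Bochner_Integration.integrable_bound[OF int]) (auto simp: T_def)
  have tp: "integrable M (\<lambda>\<omega>. trunc_prod R i j (Z \<omega>))" for i j
    by (rule integrable_const_bound[where B = "R\<^sup>2"]) (auto simp: abs_trunc_prod_le)
  show ?thesis
  proof (rule that[of "c / 2" R])
    fix y
    \<comment> \<open>A discarded sample is charged by Cauchy-Schwarz.\<close>
    have le: "(Z \<omega> \<bullet> y)\<^sup>2 \<le> (\<Sum>i\<in>UNIV. \<Sum>j\<in>UNIV. (y $ i * y $ j) * trunc_prod R i j (Z \<omega>)) + (norm y)\<^sup>2 * T R \<omega>" for \<omega>
    proof -
      have "\<bar>Z \<omega> \<bullet> y\<bar>\<^sup>2 \<le> (norm (Z \<omega>) * norm y)\<^sup>2"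
        by (intro power_mono Cauchy_Schwarz_ineq2) auto
      then show ?thesis
        unfolding sum_trunc_prod by (auto simp: T_def power_mult_distrib mult.commute)
    qed
    have "c * (norm y)\<^sup>2 \<le> expectation (\<lambda>\<omega>. (Z \<omega> \<bullet> y)\<^sup>2)" by (rule c)
    also have "\<dots> \<le> expectation (\<lambda>\<omega>. (\<Sum>i\<in>UNIV. \<Sum>j\<in>UNIV. (y $ i * y $ j) * trunc_prod R i j (Z \<omega>)) + (norm y)\<^sup>2 * T R \<omega>)"
      using tp Ti le integrable_inner_mult[OF assms(1,2), of y y]
      by (intro integral_mono) (auto simp: power2_eq_square)
    also have "\<dots> = (\<Sum>i\<in>UNIV. \<Sum>j\<in>UNIV. (y $ i * y $ j) * expectation (\<lambda>\<omega>. trunc_prod R i j (Z \<omega>))) + (norm y)\<^sup>2 * expectation (T R)"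
      using tp Ti by simp
    also have "(norm y)\<^sup>2 * expectation (T R) \<le> (norm y)\<^sup>2 * (c / 2)"
      using n by (intro mult_left_mono) (auto simp: R_def)
    finally show "c / 2 * (norm y)\<^sup>2 \<le> (\<Sum>i\<in>UNIV. \<Sum>j\<in>UNIV. (y $ i * y $ j) * expectation (\<lambda>\<omega>. trunc_prod R i j (Z \<omega>)))"
      by (simp add: field_simps)
  qed (use c n in \<open>auto simp: R_def\<close>)
qed

section \<open>Concentration\<close>

text \<open>The map that collects all coordinates is the identity on the product space, so their
  joint law is the product of the marginals.\<close>

lemma indep_vars_PiM_components:
  assumes "prob_space D" "I \<noteq> {}"
  shows "prob_space.indep_vars (PiM I (\<lambda>_. D)) (\<lambda>_. D) (\<lambda>i w. w i) I"
proof -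
  interpret P: prob_space "PiM I (\<lambda>_. D)" by (rule prob_space_PiM) (rule assms)
  have "distr (PiM I (\<lambda>_. D)) (PiM I (\<lambda>_. D)) (\<lambda>w. \<lambda>i\<in>I. w i) = distr (PiM I (\<lambda>_. D)) (PiM I (\<lambda>_. D)) (\<lambda>w. w)"
    by (intro distr_cong refl) (auto simp: space_PiM PiE_iff extensional_restrict)
  also have "\<dots> = PiM I (\<lambda>i. distr (PiM I (\<lambda>_. D)) D (\<lambda>w. w i))"
    using assms distr_PiM_component[of I "\<lambda>_. D"] by (subst distr_id, intro PiM_cong refl) simp
  finally show ?thesis
    using assms(2) by (subst P.indep_vars_iff_distr_eq_PiM') auto
qed

lemma Hoeffding_PiM:
  fixes h :: "'a \<Rightarrow> real"
  assumes "prob_space D" and [measurable]: "h \<in> borel_measurable D"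
    and bound: "\<And>x. \<bar>h x\<bar> \<le> b" and "b > 0" "m > 0" "\<delta> \<ge> 0"
  shows "measure (PiM {1..m} (\<lambda>_. D)) {w \<in> space (PiM {1..m} (\<lambda>_. D)).
      \<delta> * real m \<le> \<bar>(\<Sum>l = 1..m. h (w l)) - real m * integral\<^sup>L D h\<bar>} \<le> 2 * exp (- (\<delta>\<^sup>2 * real m / (2 * b\<^sup>2)))"
proof -
  let ?P = "PiM {1..m} (\<lambda>_. D)"
  interpret P: prob_space ?P by (rule prob_space_PiM) (rule assms)
  have ind: "P.indep_vars (\<lambda>_. borel) (\<lambda>l w. h (w l)) {1..m}"
    using \<open>m > 0\<close> assms(1)
    by (intro P.indep_vars_compose2[OF indep_vars_PiM_components]) auto
  have E: "P.expectation (\<lambda>w. h (w l)) = integral\<^sup>L D h" if "l \<in> {1..m}" for l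
  proof -
    have "P.expectation (\<lambda>w. h (w l)) = integral\<^sup>L (distr ?P D (\<lambda>w. w l)) h"
      using that by (subst integral_distr) auto
    then show ?thesis using that assms(1) distr_PiM_component[of "{1..m}" "\<lambda>_. D" l] by simp
  qed
  interpret Hoeffding_ineq ?P "{1..m}" "\<lambda>l w. h (w l)" "\<lambda>_. - b" "\<lambda>_. b" "real m * integral\<^sup>L D h"
  proof unfold_locales
    show "AE x in ?P. h (x i) \<in> {- b..b}" for i
      using bound by (auto simp: abs_le_iff minus_le_iff)
    show "real m * integral\<^sup>L D h \<equiv> \<Sum>i = 1..m. P.expectation (\<lambda>w. h (w i))"
      using E by simp
  qed (use ind in auto)
  have "P.prob {x \<in> space ?P. \<delta> * real m \<le> \<bar>(\<Sum>i = 1..m. h (x i)) - real m * integral\<^sup>L D h\<bar>}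
    \<le> 2 * exp (- 2 * (\<delta> * real m)\<^sup>2 / (\<Sum>i = 1..m. (b - - b)\<^sup>2))"
    using assms by (intro Hoeffding_ineq_abs_ge) auto
  \<comment> \<open>Each summand ranges over an interval of length 2b, so the denominator is 4 m
    b^2.\<close>
  also have "- 2 * (\<delta> * real m)\<^sup>2 / (\<Sum>i = 1..m. (b - - b)\<^sup>2) = - (\<delta>\<^sup>2 * real m / (2 * b\<^sup>2))"
    using assms by (simp add: power2_eq_square field_simps)
  finally show ?thesis .
qed

text \<open>Chernoff's method: the exponential moment of the sum factorises over the product
  measure, and the squared weights, bounded by \<open>v\<close>, add up in the exponent. The two
  tails account for the factor 2.\<close>

lemma sub_gaussian_weighted_sum_tail:
  fixes h :: "'a \<Rightarrow> real" and u :: "'i \<Rightarrow> real"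
  assumes "prob_space D" and [measurable]: "h \<in> borel_measurable D" and "finite I"
    and mgf: "\<And>t. (\<integral>\<^sup>+ x. ennreal (exp (t * h x)) \<partial>D) \<le> ennreal (exp (b * t\<^sup>2))"
    and "b > 0" "v > 0" and v: "(\<Sum>i\<in>I. (u i)\<^sup>2) \<le> v" and "t \<ge> 0"
  shows "emeasure (PiM I (\<lambda>_. D)) {e \<in> space (PiM I (\<lambda>_. D)). t \<le> \<bar>\<Sum>i\<in>I. h (e i) * u i\<bar>}
    \<le> ennreal (2 * exp (- (t\<^sup>2 / (4 * b * v))))"
proof -
  let ?P = "PiM I (\<lambda>_. D)"
  interpret D: prob_space D by fact
  interpret p: product_prob_space "\<lambda>_. D" I ..
  \<comment> \<open>The minimiser of \<open>b * s\<^sup>2 * v - s * t\<close>, with minimum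
    \<open>- (t\<^sup>2 / (4 * b * v))\<close>.\<close>
  define s where "s = t / (2 * b * v)"
  have "s \<ge> 0" using assms by (simp add: s_def)
  define Y where "Y e = (\<Sum>i\<in>I. h (e i) * u i)" for e
  have [measurable]: "Y \<in> borel_measurable ?P" unfolding Y_def by measurable
  \<comment> \<open>Only the square of r matters, so the bound serves both signs of s.\<close>
  have int: "(\<integral>\<^sup>+ e. ennreal (exp (r * Y e)) \<partial>?P) \<le> ennreal (exp (b * s\<^sup>2 * v))" if "r\<^sup>2 = s\<^sup>2" for r
  proof -
    have "(\<integral>\<^sup>+ e. ennreal (exp (r * Y e)) \<partial>?P) = (\<integral>\<^sup>+ e. (\<Prod>i\<in>I. ennreal (exp ((r * u i) * h (e i)))) \<partial>?P)"
      using \<open>finite I\<close> by (simp add: Y_def sum_distrib_left exp_sum prod_ennreal mult_ac)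
    also have "\<dots> = (\<Prod>i\<in>I. \<integral>\<^sup>+ x. ennreal (exp ((r * u i) * h x)) \<partial>D)"
      using \<open>finite I\<close> by (intro p.product_nn_integral_prod) auto
    also have "\<dots> \<le> (\<Prod>i\<in>I. ennreal (exp (b * (r * u i)\<^sup>2)))"
      by (intro prod_mono_ennreal mgf)
    also have "\<dots> = ennreal (exp (\<Sum>i\<in>I. b * (r * u i)\<^sup>2))"
      using \<open>finite I\<close> by (simp add: exp_sum prod_ennreal)
    also have "(\<Sum>i\<in>I. b * (r * u i)\<^sup>2) = b * s\<^sup>2 * (\<Sum>i\<in>I. (u i)\<^sup>2)"
      by (simp add: power_mult_distrib that sum_distrib_left mult_ac)
    also have "ennreal (exp \<dots>) \<le> ennreal (exp (b * s\<^sup>2 * v))"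
      using assms by (intro ennreal_leI) (auto intro!: mult_left_mono)
    finally show ?thesis .
  qed
  have "emeasure ?P {e \<in> space ?P. t \<le> \<bar>Y e\<bar>} = (\<integral>\<^sup>+ e. indicator {e \<in> space ?P. t \<le> \<bar>Y e\<bar>} e \<partial>?P)"
    by (intro nn_integral_indicator[symmetric]) measurable
  also have "\<dots> \<le> (\<integral>\<^sup>+ e. ennreal (exp (- s * t)) * (ennreal (exp (s * Y e)) + ennreal (exp (- s * Y e))) \<partial>?P)"
  proof (intro nn_integral_mono)
    fix e
    have "1 \<le> exp (- s * t) * (exp (s * Y e) + exp (- s * Y e))" if "t \<le> \<bar>Y e\<bar>"
    proof -
      have "s * t \<le> \<bar>s * Y e\<bar>"
        using that \<open>s \<ge> 0\<close> by (auto simp: abs_mult intro!: mult_left_mono)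
      then have "exp (s * t) \<le> exp (s * Y e) + exp (- s * Y e)"
        by (smt (verit) exp_le_cancel_iff exp_gt_zero mult_minus_left)
      then show ?thesis by (simp add: exp_minus field_simps)
    qed
    then show "indicator {e \<in> space ?P. t \<le> \<bar>Y e\<bar>} e
        \<le> ennreal (exp (- s * t)) * (ennreal (exp (s * Y e)) + ennreal (exp (- s * Y e)))"
      by (auto simp: indicator_def simp flip: ennreal_plus ennreal_mult ennreal_1)
  qed
  also have "\<dots> = ennreal (exp (- s * t)) * ((\<integral>\<^sup>+ e. ennreal (exp (s * Y e)) \<partial>?P) + (\<integral>\<^sup>+ e. ennreal (exp (- s * Y e)) \<partial>?P))"
    by (simp add: nn_integral_cmult nn_integral_add)
  also have "\<dots> \<le> ennreal (exp (- s * t)) * (ennreal (exp (b * s\<^sup>2 * v)) + ennreal (exp (b * s\<^sup>2 * v)))"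
    by (intro mult_left_mono add_mono int) auto
  also have "\<dots> = ennreal (2 * exp (b * s\<^sup>2 * v - s * t))"
    by (simp add: exp_diff exp_minus field_simps flip: ennreal_plus ennreal_mult)
  also have "b * s\<^sup>2 * v - s * t = - (t\<^sup>2 / (4 * b * v))"
    using assms by (simp add: s_def power2_eq_square field_simps)
  finally show ?thesis unfolding Y_def .
qed

text \<open>A measurable stand-in for coercivity of the Gram matrix: finitely many deviation
  conditions on sums of bounded variables, each within reach of Hoeffding's inequality.\<close>

definition balanced_design :: "real \<Rightarrow> ('d \<Rightarrow> 'd \<Rightarrow> real) \<Rightarrow> real \<Rightarrow> nat \<Rightarrow> (nat \<Rightarrow> real ^ 'd) \<Rightarrow> bool" where
  "balanced_design R \<mu> \<delta> m z \<longleftrightarrow>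
     (\<forall>i j. \<bar>(\<Sum>l = 1..m. trunc_prod R i j (z l)) - real m * \<mu> i j\<bar> < \<delta> * real m)"

text \<open>An error of at most \<delta> m in each entry changes the quadratic form by at most
  \<delta> m times the squared l1 norm of y, hence by at most half of the mean form. Restoring the
  discarded samples only increases the form.\<close>

lemma balanced_design_coercive:
  fixes z :: "nat \<Rightarrow> real ^ 'd"
  assumes "balanced_design R \<mu> \<delta> m z"
    and \<mu>: "\<And>y :: real ^ 'd. c * (norm y)\<^sup>2 \<le> (\<Sum>i\<in>UNIV. \<Sum>j\<in>UNIV. (y $ i * y $ j) * \<mu> i j)"
    and \<delta>: "\<delta> * real CARD('d) \<le> c / 2" "\<delta> \<ge> 0"
  shows "c / 2 * real m * (norm y)\<^sup>2 \<le> (\<Sum>l = 1..m. (z l \<bullet> y)\<^sup>2)"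
proof -
  define \<tau> where "\<tau> i j = (\<Sum>l = 1..m. trunc_prod R i j (z l))" for i j
  have \<tau>: "\<bar>\<tau> i j - real m * \<mu> i j\<bar> \<le> \<delta> * real m" for i j
    using assms(1) unfolding balanced_design_def \<tau>_def by (auto intro: less_imp_le)
  have "real m * (c * (norm y)\<^sup>2) - \<delta> * real m * (\<Sum>i\<in>UNIV. \<bar>y $ i\<bar>)\<^sup>2
      \<le> real m * (\<Sum>i\<in>UNIV. \<Sum>j\<in>UNIV. (y $ i * y $ j) * \<mu> i j) - \<delta> * real m * (\<Sum>i\<in>UNIV. \<bar>y $ i\<bar>)\<^sup>2"
    by (intro diff_right_mono mult_left_mono \<mu>) simp
  also have "\<dots> = (\<Sum>i\<in>UNIV. \<Sum>j\<in>UNIV. (y $ i * y $ j) * (real m * \<mu> i j) - \<bar>y $ i * y $ j\<bar> * (\<delta> * real m))"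
    by (simp add: power2_eq_square sum_product sum_distrib_left sum_subtractf abs_mult mult_ac)
  also have "\<dots> \<le> (\<Sum>i\<in>UNIV. \<Sum>j\<in>UNIV. (y $ i * y $ j) * \<tau> i j)"
  proof (intro sum_mono)
    fix i j
    have "\<bar>(y $ i * y $ j) * (\<tau> i j - real m * \<mu> i j)\<bar> \<le> \<bar>y $ i * y $ j\<bar> * (\<delta> * real m)"
      unfolding abs_mult[of "y $ i * y $ j"] by (intro mult_left_mono \<tau>) auto
    then show "(y $ i * y $ j) * (real m * \<mu> i j) - \<bar>y $ i * y $ j\<bar> * (\<delta> * real m) \<le> (y $ i * y $ j) * \<tau> i j"
      unfolding right_diff_distrib by linarith
  qed
  also have "\<dots> = (\<Sum>i\<in>UNIV. \<Sum>l = 1..m. \<Sum>j\<in>UNIV. (y $ i * y $ j) * trunc_prod R i j (z l))"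
    unfolding \<tau>_def sum_distrib_left by (intro sum.cong refl sum.swap)
  also have "\<dots> = (\<Sum>l = 1..m. \<Sum>i\<in>UNIV. \<Sum>j\<in>UNIV. (y $ i * y $ j) * trunc_prod R i j (z l))"
    by (rule sum.swap)
  also have "\<dots> \<le> (\<Sum>l = 1..m. (z l \<bullet> y)\<^sup>2)"
    unfolding sum_trunc_prod by (intro sum_mono) auto
  finally have *: "real m * (c * (norm y)\<^sup>2) - \<delta> * real m * (\<Sum>i\<in>UNIV. \<bar>y $ i\<bar>)\<^sup>2 \<le> (\<Sum>l = 1..m. (z l \<bullet> y)\<^sup>2)" .
  \<comment> \<open>Cauchy-Schwarz compares the l1 and l2 norms; this is where the dimension enters
    the condition on \<delta>.\<close>
  have "(\<Sum>i\<in>UNIV. \<bar>y $ i\<bar>)\<^sup>2 \<le> (norm y)\<^sup>2 * real CARD('d)"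
    using sum_squared_le_sum_of_squares[of "\<lambda>i. \<bar>y $ i\<bar>" UNIV]
    by (simp add: norm_vec_def L2_set_def sum_nonneg)
  then have "\<delta> * real m * (\<Sum>i\<in>UNIV. \<bar>y $ i\<bar>)\<^sup>2 \<le> \<delta> * real m * ((norm y)\<^sup>2 * real CARD('d))"
    using \<delta> by (intro mult_left_mono) auto
  also have "\<dots> = (\<delta> * real CARD('d)) * (real m * (norm y)\<^sup>2)" by (simp add: mult_ac)
  also have "\<dots> \<le> c / 2 * (real m * (norm y)\<^sup>2)"
    using \<delta> by (intro mult_right_mono) auto
  finally show ?thesis using * by (simp add: algebra_simps)
qed

lemma borel_measurable_pinv_col_nth:
  fixes f :: "'a \<Rightarrow> nat \<Rightarrow> real ^ 'd"
  assumes "\<And>l. l \<in> {1..m} \<Longrightarrow> (\<lambda>x. f x l) \<in> borel_measurable M" and "l \<in> {1..m}"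
  shows "(\<lambda>x. pinv_col m (f x) l $ j) \<in> borel_measurable M"
proof -
  note assms(1)[measurable]
  have [measurable]: "(\<lambda>x. f x k $ i) \<in> borel_measurable M" if "k \<in> {1..m}" for k i
    using that by measurable
  have [measurable]: "(\<lambda>x. gram m (f x)) \<in> borel_measurable M"
    by (intro borel_measurable_vec) (simp add: gram_def)
  show ?thesis
    using assms(2) by (simp add: pinv_col_def matrix_vector_mult_def)
qed

text \<open>Points of a finite product space are fixed outside the index set, so families are
  compared on the indices 1 to m only.\<close>

lemma balanced_design_cong:
  "(\<And>l. l \<in> {1..m} \<Longrightarrow> z l = z' l) \<Longrightarrow> balanced_design R \<mu> \<delta> m z = balanced_design R \<mu> \<delta> m z'"
  by (simp add: balanced_design_def)

lemma pinv_col_cong: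
  "(\<And>l. l \<in> {1..m} \<Longrightarrow> z l = z' l) \<Longrightarrow> l \<in> {1..m} \<Longrightarrow> pinv_col m z l = pinv_col m z' l"
  by (simp add: pinv_col_def gram_def)

lemma pred_balanced_design:
  assumes "\<And>l. l \<in> {1..m} \<Longrightarrow> (\<lambda>x. f x l) \<in> borel_measurable M"
  shows "Measurable.pred M (\<lambda>x. balanced_design R \<mu> \<delta> m (f x))"
  using assms unfolding balanced_design_def by measurable

lemma exp_minus_linear_le_inverse_square:
  assumes "\<rho> > 0" 
  shows "\<forall>\<^sub>F m in sequentially. a * exp (- (\<rho> * real m)) \<le> 1 / (2 * (real m)\<^sup>2)"
proof -
  have "(\<lambda>m. a * ((real m)\<^sup>2 * exp (- (\<rho> * real m)))) \<longlonglongrightarrow> a * 0"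
    using assms by (intro tendsto_mult_left) real_asymp
  then have "\<forall>\<^sub>F m in sequentially. a * ((real m)\<^sup>2 * exp (- (\<rho> * real m))) < 1 / 2"
    by (rule order_tendstoD) simp
  then show ?thesis
    using eventually_gt_at_top[of 0] by eventually_elim (simp add: field_simps)
qed

text \<open>The failure probability is split in halves of 1/m^2. The design fails with exponentially
  small probability. On a balanced design each of the k d coefficient errors fails with probability
  at most 2/m^3, and these add up to at most 1/(2 m^2) once m \<ge> 4 k d.\<close>

lemma regression_noise_concentration:
  fixes D1 :: "(real ^ 'd) measure" and D2 :: "(real ^ 'k) measure"
  assumes "prob_space D1" "prob_space D2"
    and sets_D [measurable_cong]: "sets D1 = sets borel" "sets D2 = sets borel"
    and mgf: "\<And>a t. (\<integral>\<^sup>+ e. ennreal (exp (t * e $ a)) \<partial>D2) \<le> ennreal (exp (b * t\<^sup>2))" and "b > 0"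
    and "c > 0" "R > 0"
    and mom: "\<And>y. c * (norm y)\<^sup>2 \<le> (\<Sum>i\<in>UNIV. \<Sum>j\<in>UNIV. (y $ i * y $ j) * (\<integral>z. trunc_prod R i j z \<partial>D1))"
  shows "\<exists>A>0. \<exists>\<kappa>>0. \<forall>\<^sub>F m in sequentially. \<exists>G\<in>sets (PiM {1..m} (\<lambda>_. D1 \<Otimes>\<^sub>M D2)).
    measure (PiM {1..m} (\<lambda>_. D1 \<Otimes>\<^sub>M D2)) G \<ge> 1 - 1 / (real m)\<^sup>2 \<and>
    (\<forall>w\<in>G. (\<forall>y. \<kappa> * real m * (norm y)\<^sup>2 \<le> (\<Sum>l = 1..m. (fst (w l) \<bullet> y)\<^sup>2)) \<and>
       (\<forall>a j. (\<Sum>l = 1..m. snd (w l) $ a * pinv_col m (\<lambda>l. fst (w l)) l $ j)\<^sup>2 \<le> A * (ln (real m) / real m)))"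
proof -
  define d k where "d = real CARD('d)" and "k = real CARD('k)"
  have dk: "d > 0" "k > 0" by (auto simp: d_def k_def)
  \<comment> \<open>Chosen so that \<delta> times the dimension is exactly half of
    \<open>c\<close>.\<close>
  define \<delta> where "\<delta> = c / (2 * d)"
  define \<mu> where "\<mu> i j = (\<integral>z. trunc_prod R i j z \<partial>D1)" for i j
  define \<kappa> where "\<kappa> = c / 2"
  \<comment> \<open>Chosen so that the Chernoff exponent becomes exactly 3 ln m.\<close>
  define A where "A = 12 * b / \<kappa>"
  \<comment> \<open>The rate in Hoeffding's inequality for variables bounded by
    \<open>R\<^sup>2\<close>.\<close>
  define \<rho> where "\<rho> = \<delta>\<^sup>2 / (2 * (R\<^sup>2)\<^sup>2)"
  have pos: "\<delta> > 0" "\<kappa> > 0" "A > 0" "\<rho> > 0"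
    using \<open>c > 0\<close> \<open>R > 0\<close> \<open>b > 0\<close> dk by (auto simp: \<delta>_def \<kappa>_def A_def \<rho>_def)
  interpret D1: prob_space D1 by fact
  interpret D2: prob_space D2 by fact
  interpret D: pair_prob_space D1 D2 ..
  have "\<forall>\<^sub>F m in sequentially. 2 * d\<^sup>2 * exp (- (\<rho> * real m)) \<le> 1 / (2 * (real m)\<^sup>2)"
    by (rule exp_minus_linear_le_inverse_square) (rule pos)
  moreover have "\<forall>\<^sub>F m in sequentially. 4 * k * d \<le> real m"
    using filterlim_real_sequentially by (simp add: filterlim_at_top)
  ultimately have "\<forall>\<^sub>F m in sequentially. \<exists>G\<in>sets (PiM {1..m} (\<lambda>_. D1 \<Otimes>\<^sub>M D2)).
    measure (PiM {1..m} (\<lambda>_. D1 \<Otimes>\<^sub>M D2)) G \<ge> 1 - 1 / (real m)\<^sup>2 \<and>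
    (\<forall>w\<in>G. (\<forall>y. \<kappa> * real m * (norm y)\<^sup>2 \<le> (\<Sum>l = 1..m. (fst (w l) \<bullet> y)\<^sup>2)) \<and>
       (\<forall>a j. (\<Sum>l = 1..m. snd (w l) $ a * pinv_col m (\<lambda>l. fst (w l)) l $ j)\<^sup>2 \<le> A * (ln (real m) / real m)))"
    using eventually_gt_at_top[of 0]
  proof eventually_elim
    case (elim m)
    note One_nat_def [simp del]
    let ?N = "PiM {1..m} (\<lambda>_. D1 \<Otimes>\<^sub>M D2)" and ?P1 = "PiM {1..m} (\<lambda>_. D1)" and ?P2 = "PiM {1..m} (\<lambda>_. D2)"
    interpret N: prob_space ?N by (rule prob_space_PiM) unfold_locales
    interpret P1: prob_space ?P1 by (rule prob_space_PiM) unfold_locales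
    interpret P2: prob_space ?P2 by (rule prob_space_PiM) unfold_locales
    define t where "t = sqrt (A * (ln (real m) / real m))"
    have t2: "t\<^sup>2 = A * (ln (real m) / real m)" and "t \<ge> 0"
      using elim pos by (auto simp: t_def)
    define bal where "bal z = balanced_design R \<mu> \<delta> m z" for z
    define Y where "Y w a j = (\<Sum>l = 1..m. snd (w l) $ a * pinv_col m (\<lambda>l. fst (w l)) l $ j)"
      for w :: "nat \<Rightarrow> (real ^ 'd) \<times> (real ^ 'k)" and a j
    have [measurable]: "(\<lambda>w. fst (w l)) \<in> borel_measurable ?N" "(\<lambda>w. snd (w l)) \<in> borel_measurable ?N" if "l \<in> {1..m}" for l
      using that by measurable
    have [measurable]: "Measurable.pred ?N (\<lambda>w. bal (\<lambda>l. fst (w l)))"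
      unfolding bal_def by (rule pred_balanced_design) measurable
    have [measurable]: "Measurable.pred ?P1 (\<lambda>z. bal z)"
      unfolding bal_def by (rule pred_balanced_design) measurable
    have [measurable]: "(\<lambda>w. Y w a j) \<in> borel_measurable ?N" for a j
      unfolding Y_def
      by (intro borel_measurable_sum borel_measurable_times borel_measurable_pinv_col_nth) measurable
    define B1 where "B1 = {w \<in> space ?N. \<not> bal (\<lambda>l. fst (w l))}"
    \<comment> \<open>The noise event is restricted to balanced designs, because only there the
      weights are under control; the others belong to \<open>B1\<close>.\<close>
    define B2 where "B2 a j = {w \<in> space ?N. bal (\<lambda>l. fst (w l)) \<and> t \<le> \<bar>Y w a j\<bar>}" for a j
    have B_sets [measurable]: "B1 \<in> sets ?N" "B2 a j \<in> sets ?N" for a j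
      unfolding B1_def B2_def by measurable
    have zip: "(\<lambda>i\<in>{1..m}. (z i, e i)) \<in> space ?N" if "z \<in> space ?P1" "e \<in> space ?P2" for z e
      using that by (auto simp: space_PiM space_pair_measure)
    have balzip: "bal (\<lambda>l. fst ((\<lambda>i\<in>{1..m}. (z i, e i)) l)) = bal z" for z and e :: "nat \<Rightarrow> real ^ 'k"
      unfolding bal_def by (rule balanced_design_cong) simp
    have Yzip: "Y (\<lambda>i\<in>{1..m}. (z i, e i)) a j = (\<Sum>l\<in>{1..m}. e l $ a * pinv_col m z l $ j)" for z e a j
      unfolding Y_def
    proof (rule sum.cong)
      fix l assume l: "l \<in> {1..m}"
      have "pinv_col m (\<lambda>l. fst ((\<lambda>i\<in>{1..m}. (z i, e i)) l)) l = pinv_col m z l"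
        by (rule pinv_col_cong) (use l in auto)
      then show "snd ((\<lambda>i\<in>{1..m}. (z i, e i)) l) $ a * pinv_col m (\<lambda>l. fst ((\<lambda>i\<in>{1..m}. (z i, e i)) l)) l $ j
          = e l $ a * pinv_col m z l $ j"
        using l by simp
    qed simp
    have "emeasure ?N B1 \<le> ennreal (1 / (2 * (real m)\<^sup>2))"
    proof -
      define C where "C i j = {z \<in> space ?P1. \<delta> * real m \<le> \<bar>(\<Sum>l = 1..m. trunc_prod R i j (z l)) - real m * \<mu> i j\<bar>}" for i j
      have C_sets: "C i j \<in> sets ?P1" for i j unfolding C_def by measurable
      have "emeasure ?N B1 = (\<integral>\<^sup>+ w. indicator B1 w \<partial>?N)"
        by (rule nn_integral_indicator[OF B_sets(1), symmetric])
      also have "\<dots> = (\<integral>\<^sup>+ z. (\<integral>\<^sup>+ e. indicator B1 (\<lambda>i\<in>{1..m}. (z i, e i)) \<partial>?P2) \<partial>?P1)"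
        using assms by (intro nn_integral_PiM_pair_measure) auto
      \<comment> \<open>Balance depends on the design alone, so the inner integral over the noise is
        trivial.\<close>
      also have "\<dots> = (\<integral>\<^sup>+ z. (\<integral>\<^sup>+ e. indicator {z \<in> space ?P1. \<not> bal z} z \<partial>?P2) \<partial>?P1)"
        by (intro nn_integral_cong) (simp add: B1_def indicator_def balzip zip del: restrict_apply)
      also have "\<dots> = emeasure ?P1 {z \<in> space ?P1. \<not> bal z}"
        by (simp add: P2.emeasure_space_1)
      also have "\<dots> = ennreal (P1.prob {z \<in> space ?P1. \<not> bal z})"
        by (rule P1.emeasure_eq_measure)
      also have "P1.prob {z \<in> space ?P1. \<not> bal z} \<le> P1.prob (\<Union>i. \<Union>j. C i j)"
        using C_sets by (intro P1.finite_measure_mono) (auto simp: bal_def balanced_design_def C_def not_less)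
      also have "\<dots> \<le> (\<Sum>i\<in>UNIV. \<Sum>j\<in>UNIV. P1.prob (C i j))"
        using C_sets by (intro order_trans[OF P1.finite_measure_subadditive_finite] sum_mono P1.finite_measure_subadditive_finite) auto
      also have "\<dots> \<le> (\<Sum>i\<in>(UNIV :: 'd set). \<Sum>j\<in>(UNIV :: 'd set). 2 * exp (- (\<rho> * real m)))"
      proof (intro sum_mono)
        fix i j :: 'd
        have "P1.prob (C i j) \<le> 2 * exp (- (\<delta>\<^sup>2 * real m / (2 * (R\<^sup>2)\<^sup>2)))"
          unfolding C_def \<mu>_def
          using pos \<open>R > 0\<close> elim by (intro Hoeffding_PiM[OF \<open>prob_space D1\<close>] abs_trunc_prod_le) auto
        then show "P1.prob (C i j) \<le> 2 * exp (- (\<rho> * real m))" by (simp add: \<rho>_def)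
      qed
      also have "\<dots> = 2 * d\<^sup>2 * exp (- (\<rho> * real m))"
        by (simp add: d_def power2_eq_square)
      also have "\<dots> \<le> 1 / (2 * (real m)\<^sup>2)" by (rule elim)
      finally show ?thesis by (simp add: ennreal_leI)
    qed
    then have p1: "N.prob B1 \<le> 1 / (2 * (real m)\<^sup>2)"
      by (simp add: N.emeasure_eq_measure)
    have p2: "N.prob (B2 a j) \<le> 2 / (real m) ^ 3" for a j
    proof -
      have "emeasure ?N (B2 a j) = (\<integral>\<^sup>+ w. indicator (B2 a j) w \<partial>?N)"
        by (rule nn_integral_indicator[OF B_sets(2), symmetric])
      also have "\<dots> = (\<integral>\<^sup>+ z. (\<integral>\<^sup>+ e. indicator (B2 a j) (\<lambda>i\<in>{1..m}. (z i, e i)) \<partial>?P2) \<partial>?P1)"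
        using assms by (intro nn_integral_PiM_pair_measure) auto
      \<comment> \<open>The tail is bounded uniformly for each fixed design: the weights are then
        constants. For an unbalanced design the integrand is zero.\<close>
      also have "\<dots> \<le> (\<integral>\<^sup>+ z. ennreal (2 / (real m) ^ 3) \<partial>?P1)"
      proof (intro nn_integral_mono)
        fix z assume z: "z \<in> space ?P1"
        show "(\<integral>\<^sup>+ e. indicator (B2 a j) (\<lambda>i\<in>{1..m}. (z i, e i)) \<partial>?P2) \<le> ennreal (2 / (real m) ^ 3)"
        proof (cases "bal z")
          case True
          have co: "\<kappa> * real m * (norm y)\<^sup>2 \<le> (\<Sum>l = 1..m. (z l \<bullet> y)\<^sup>2)" for y
            unfolding \<kappa>_def using True mom pos dk
            by (intro balanced_design_coercive[where \<mu> = \<mu> and \<delta> = \<delta> and R = R]) (auto simp: bal_def \<mu>_def \<delta>_def d_def)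
          have v: "(\<Sum>l\<in>{1..m}. (pinv_col m z l $ j)\<^sup>2) \<le> 1 / (\<kappa> * real m)"
            by (rule sum_pinv_col_square_le[OF co]) (use pos elim in auto)
          have "(\<integral>\<^sup>+ e. indicator (B2 a j) (\<lambda>i\<in>{1..m}. (z i, e i)) \<partial>?P2)
              = (\<integral>\<^sup>+ e. indicator {e \<in> space ?P2. t \<le> \<bar>\<Sum>l\<in>{1..m}. e l $ a * pinv_col m z l $ j\<bar>} e \<partial>?P2)"
            unfolding B2_def using True z
            by (intro nn_integral_cong) (simp add: indicator_def balzip zip Yzip del: restrict_apply)
          also have "\<dots> = emeasure ?P2 {e \<in> space ?P2. t \<le> \<bar>\<Sum>l\<in>{1..m}. e l $ a * pinv_col m z l $ j\<bar>}"
            by (intro nn_integral_indicator) measurable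
          also have "\<dots> \<le> ennreal (2 * exp (- (t\<^sup>2 / (4 * b * (1 / (\<kappa> * real m))))))"
            using elim pos \<open>b > 0\<close>
            by (intro sub_gaussian_weighted_sum_tail[where h = "\<lambda>e. e $ a" and u = "\<lambda>l. pinv_col m z l $ j"] assms v mgf \<open>t \<ge> 0\<close>) auto
          also have "t\<^sup>2 / (4 * b * (1 / (\<kappa> * real m))) = 3 * ln (real m)"
            using elim pos \<open>b > 0\<close> by (simp add: t2 A_def field_simps)
          also have "exp (- (3 * ln (real m))) = 1 / (real m) ^ 3"
            using elim by (simp add: exp_minus exp_of_nat_mult[of 3, simplified] inverse_eq_divide)
          also have "2 * (1 / (real m) ^ 3) = 2 / (real m) ^ 3" by simp
          finally show ?thesis .
        qed (simp add: B2_def balzip del: restrict_apply)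
      qed
      also have "\<dots> = ennreal (2 / (real m) ^ 3)" by (simp add: P1.emeasure_space_1)
      finally show ?thesis by (simp add: N.emeasure_eq_measure)
    qed
    define G where "G = space ?N - (B1 \<union> (\<Union>a. \<Union>j. B2 a j))"
    have G: "G \<in> sets ?N" unfolding G_def using B_sets by (intro sets.Diff sets.Un sets.finite_UN) auto
    have "N.prob (B1 \<union> (\<Union>a. \<Union>j. B2 a j)) \<le> N.prob B1 + N.prob (\<Union>a. \<Union>j. B2 a j)"
      using B_sets by (intro measure_Un_le sets.finite_UN) auto
    also have "N.prob (\<Union>a. \<Union>j. B2 a j) \<le> (\<Sum>a\<in>UNIV. \<Sum>j\<in>UNIV. N.prob (B2 a j))"
      using B_sets by (intro order_trans[OF N.finite_measure_subadditive_finite] sum_mono N.finite_measure_subadditive_finite) auto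
    also have "\<dots> \<le> (\<Sum>a\<in>(UNIV :: 'k set). \<Sum>j\<in>(UNIV :: 'd set). 2 / (real m) ^ 3)"
      by (intro sum_mono p2)
    also have "\<dots> = (4 * k * d) / (2 * (real m) ^ 3)" by (simp add: d_def k_def)
    \<comment> \<open>Here m \<ge> 4 k d trades one power of m for the number of
      coefficients.\<close>
    also have "\<dots> \<le> real m / (2 * (real m) ^ 3)"
      using elim by (intro divide_right_mono) auto
    also have "\<dots> = 1 / (2 * (real m)\<^sup>2)" using elim by (simp add: power2_eq_square power3_eq_cube)
    finally have "N.prob (B1 \<union> (\<Union>a. \<Union>j. B2 a j)) \<le> 1 / (real m)\<^sup>2" using p1 by simp
    moreover have "N.prob G = 1 - N.prob (B1 \<union> (\<Union>a. \<Union>j. B2 a j))"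
      unfolding G_def using B_sets by (intro N.prob_compl sets.Un sets.finite_UN) auto
    ultimately have "N.prob G \<ge> 1 - 1 / (real m)\<^sup>2" by simp
    moreover have "\<kappa> * real m * (norm y)\<^sup>2 \<le> (\<Sum>l = 1..m. (fst (w l) \<bullet> y)\<^sup>2)" if "w \<in> G" for w y
      unfolding \<kappa>_def using that mom pos dk
      by (intro balanced_design_coercive[where \<mu> = \<mu> and \<delta> = \<delta> and R = R])
        (auto simp: G_def B1_def bal_def \<mu>_def \<delta>_def d_def)
    moreover have "(Y w a j)\<^sup>2 \<le> A * (ln (real m) / real m)" if "w \<in> G" for w a j
    proof -
      have "\<bar>Y w a j\<bar> \<le> t" using that by (auto simp: G_def B1_def B2_def not_le intro: less_imp_le)
      then have "\<bar>Y w a j\<bar>\<^sup>2 \<le> t\<^sup>2" by (intro power_mono) auto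
      then show ?thesis by (simp add: t2)
    qed
    ultimately show ?case using G unfolding Y_def by blast
  qed
  then show ?thesis using pos by blast
qed

section \<open>The conditional risk\<close>

text \<open>Freezing lemma: conditioning on U, one integrates over the independent V with U held
  fixed. The defining identity is checked on the preimages under U of measurable sets, where it is
  Fubini for the product law.\<close>

lemma nn_cond_exp_indep_rv:
  assumes "prob_space P" and indep: "indep_rv P A U B V"
    and [measurable]: "\<phi> \<in> borel_measurable (A \<Otimes>\<^sub>M B)"
  shows "AE \<omega> in P. nn_cond_exp P (vimage_algebra (space P) U A) (\<lambda>\<omega>. \<phi> (U \<omega>, V \<omega>)) \<omega>
    = (\<integral>\<^sup>+ \<omega>'. \<phi> (U \<omega>, V \<omega>') \<partial>P)"
proof -
  interpret prob_space P by fact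
  have U [measurable]: "U \<in> measurable P A" and V [measurable]: "V \<in> measurable P B"
    using indep by (auto simp: indep_rv_def)
  let ?F = "vimage_algebra (space P) U A"
  have sets_F: "sets ?F = {U -` a \<inter> space P | a. a \<in> sets A}"
    using measurable_space[OF U] by (intro sets_vimage_algebra2) auto
  have sub: "subalgebra P ?F"
    unfolding subalgebra_def sets_F by auto
  interpret F: finite_measure_subalgebra P ?F
    by unfold_locales (rule sub)
  define h where "h u = (\<integral>\<^sup>+ \<omega>'. \<phi> (u, V \<omega>') \<partial>P)" for u
  have h [measurable]: "h \<in> borel_measurable A" unfolding h_def by measurable
  have UF: "U \<in> measurable ?F A"
    using measurable_space[OF U] by (intro measurable_vimage_algebra1) auto
  have "AE \<omega> in P. h (U \<omega>) = nn_cond_exp P ?F (\<lambda>\<omega>. \<phi> (U \<omega>, V \<omega>)) \<omega>"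
  proof (rule F.nn_cond_exp_charact)
    fix S assume "S \<in> sets ?F"
    then obtain a where a [measurable]: "a \<in> sets A" and S: "S = U -` a \<inter> space P"
      unfolding sets_F by auto
    interpret L1: prob_space "distr P A U" by (rule prob_space_distr) measurable
    interpret L2: prob_space "distr P B V" by (rule prob_space_distr) measurable
    have "(\<integral>\<^sup>+ \<omega>\<in>S. \<phi> (U \<omega>, V \<omega>) \<partial>P) = (\<integral>\<^sup>+ \<omega>. (\<lambda>(u, v). \<phi> (u, v) * indicator a u) (U \<omega>, V \<omega>) \<partial>P)"
      by (intro nn_integral_cong) (auto simp: S indicator_def)
    also have "\<dots> = (\<integral>\<^sup>+ x. (\<lambda>(u, v). \<phi> (u, v) * indicator a u) x \<partial>distr P (A \<Otimes>\<^sub>M B) (\<lambda>\<omega>. (U \<omega>, V \<omega>)))"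
      by (subst nn_integral_distr) measurable
    also have "\<dots> = (\<integral>\<^sup>+ x. (\<lambda>(u, v). \<phi> (u, v) * indicator a u) x \<partial>(distr P A U \<Otimes>\<^sub>M distr P B V))"
      using indep_rv_distr_pair[OF assms(1) indep] by simp
    also have "\<dots> = (\<integral>\<^sup>+ u. (\<integral>\<^sup>+ v. \<phi> (u, v) * indicator a u \<partial>distr P B V) \<partial>distr P A U)"
      by (subst L2.nn_integral_fst[symmetric]) auto
    also have "\<dots> = (\<integral>\<^sup>+ u. h u * indicator a u \<partial>distr P A U)"
      unfolding h_def by (intro nn_integral_cong) (simp add: nn_integral_distr nn_integral_multc)
    also have "\<dots> = (\<integral>\<^sup>+ \<omega>. h (U \<omega>) * indicator a (U \<omega>) \<partial>P)"
      by (subst nn_integral_distr) measurable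
    also have "\<dots> = (\<integral>\<^sup>+ \<omega>\<in>S. h (U \<omega>) \<partial>P)"
      by (intro nn_integral_cong) (auto simp: S indicator_def)
    finally show "(\<integral>\<^sup>+ \<omega>\<in>S. \<phi> (U \<omega>, V \<omega>) \<partial>P) = (\<integral>\<^sup>+ \<omega>\<in>S. h (U \<omega>) \<partial>P)" .
  next
    show "(\<lambda>\<omega>. h (U \<omega>)) \<in> borel_measurable ?F"
      by (rule measurable_compose[OF UF h])
  qed measurable
  then show ?thesis by eventually_elim (simp add: h_def)
qed

text \<open>Additivity of variances: the cross term with the remaining sum factorises by
  independence and vanishes because the variables are centred.\<close>

lemma (in prob_space) expectation_square_sum_indep:
  fixes Y :: "'i \<Rightarrow> 'a \<Rightarrow> real"
  assumes "finite I" "indep_vars (\<lambda>_. borel) Y I"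
    and "\<And>i. i \<in> I \<Longrightarrow> integrable M (\<lambda>\<omega>. (Y i \<omega>)\<^sup>2)" "\<And>i. i \<in> I \<Longrightarrow> expectation (Y i) = 0"
  shows "integrable M (\<lambda>\<omega>. (\<Sum>i\<in>I. Y i \<omega>)\<^sup>2) \<and>
    expectation (\<lambda>\<omega>. (\<Sum>i\<in>I. Y i \<omega>)\<^sup>2) = (\<Sum>i\<in>I. expectation (\<lambda>\<omega>. (Y i \<omega>)\<^sup>2))"
  using assms
proof (induction I rule: finite_induct)
  case (insert i I)
  have rv: "random_variable borel (Y j)" if "j \<in> insert i I" for j
    using insert.prems(1) that unfolding indep_vars_def by blast
  note rv[measurable]
  have int: "integrable M (Y j)" if "j \<in> insert i I" for j
    using rv[OF that] insert.prems(2)[OF that] by (rule square_integrable_imp_integrable)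
  have IH: "integrable M (\<lambda>\<omega>. (\<Sum>j\<in>I. Y j \<omega>)\<^sup>2)"
    "expectation (\<lambda>\<omega>. (\<Sum>j\<in>I. Y j \<omega>)\<^sup>2) = (\<Sum>j\<in>I. expectation (\<lambda>\<omega>. (Y j \<omega>)\<^sup>2))"
    using insert.IH indep_vars_subset[OF insert.prems(1), of I] insert.prems by auto
  have ind: "indep_var borel (Y i) borel (\<lambda>\<omega>. \<Sum>j\<in>I. Y j \<omega>)"
    using insert by (intro indep_vars_sum) auto
  have S: "integrable M (\<lambda>\<omega>. \<Sum>j\<in>I. Y j \<omega>)"
    using int by (intro Bochner_Integration.integrable_sum) auto
  have cross: "integrable M (\<lambda>\<omega>. Y i \<omega> * (\<Sum>j\<in>I. Y j \<omega>))"
    "expectation (\<lambda>\<omega>. Y i \<omega> * (\<Sum>j\<in>I. Y j \<omega>)) = 0"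
    using indep_var_integrable[OF ind int S] indep_var_lebesgue_integral[OF ind int S] insert.prems(3)[of i] by auto
  have "(\<Sum>j\<in>insert i I. Y j \<omega>)\<^sup>2 = (Y i \<omega>)\<^sup>2 + 2 * (Y i \<omega> * (\<Sum>j\<in>I. Y j \<omega>)) + (\<Sum>j\<in>I. Y j \<omega>)\<^sup>2" for \<omega>
    using insert.hyps by (simp add: power2_sum mult_ac)
  then show ?case
    using insert.prems(2)[of i] IH cross insert.hyps by simp
qed simp

lemma trace_conj:
  fixes A :: "real ^ 'n ^ 'm" and S :: "real ^ 'n ^ 'n"
  shows "trace (A ** S ** transpose A) = (\<Sum>a\<in>UNIV. A $ a \<bullet> (S *v (A $ a)))"
proof -
  have "(A ** S ** transpose A) $ a $ a = A $ a \<bullet> (S *v (A $ a))" for a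
    by (simp add: matrix_matrix_mult_def matrix_vector_mult_def transpose_def inner_vec_def
        sum_distrib_left sum_distrib_right mult_ac, subst sum.swap, simp add: mult_ac)
  then show ?thesis by (simp add: trace_def)
qed

text \<open>Cyclicity of the trace brings the trace of the risk bound into the conjugated form with
  \<open>Q ** \<beta>\<close>, which is a total variance.\<close>

lemma trace_gram_conj:
  fixes Q :: "real ^ 'k ^ 'q" and \<beta> :: "real ^ 'd ^ 'k" and S :: "real ^ 'd ^ 'd"
  shows "trace (S ** transpose \<beta> ** transpose Q ** Q ** \<beta>) = trace ((Q ** \<beta>) ** S ** transpose (Q ** \<beta>))"
proof -
  have "S ** transpose \<beta> ** transpose Q ** Q ** \<beta> = (S ** transpose (Q ** \<beta>)) ** (Q ** \<beta>)"
    by (simp add: matrix_transpose_mul matrix_mul_assoc)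
  then show ?thesis
    by (metis matrix_mul_assoc trace_mul_sym)
qed

lemma integral_vec_nth:
  fixes V :: "'a \<Rightarrow> real ^ 'd"
  assumes "integrable M V"
  shows "(\<integral>\<omega>. V \<omega> $ i \<partial>M) = integral\<^sup>L M V $ i"
  using integral_bounded_linear[OF bounded_linear_vec_nth assms] .

lemma cov_matrix_eq_second_moment:
  fixes V :: "'a \<Rightarrow> real ^ 'd"
  assumes "integrable M V"
  shows "cov_matrix M V = second_moment_matrix M (\<lambda>\<omega>. V \<omega> - integral\<^sup>L M V)"
  by (simp add: cov_matrix_def second_moment_matrix_def integral_vec_nth[OF assms])

text \<open>The diagonal entries of the conjugated covariance are the variances of the coordinates
  of A V, so the trace is the total variance of A V.\<close>

lemma (in prob_space) trace_conj_cov_matrix: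
  fixes V :: "'a \<Rightarrow> real ^ 'd" and A :: "real ^ 'd ^ 'm"
  assumes [measurable]: "V \<in> borel_measurable M" and int: "integrable M (\<lambda>\<omega>. (norm (V \<omega>))\<^sup>2)"
  shows "integrable M V"
    and "integrable M (\<lambda>\<omega>. ((V \<omega> - expectation V) \<bullet> x)\<^sup>2)"
    and "trace (A ** cov_matrix M V ** transpose A) = (\<Sum>a\<in>UNIV. expectation (\<lambda>\<omega>. ((V \<omega> - expectation V) \<bullet> (A $ a))\<^sup>2))"
proof -
  have "integrable M (\<lambda>\<omega>. norm (V \<omega>))"
    by (rule square_integrable_imp_integrable) (auto simp: int)
  then show V: "integrable M V" by (subst (asm) integrable_norm_iff) auto
  have "integrable M (\<lambda>\<omega>. 2 * (norm (V \<omega>))\<^sup>2 + 2 * (norm (expectation V))\<^sup>2)" using int by simp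
  then have c: "integrable M (\<lambda>\<omega>. (norm (V \<omega> - expectation V))\<^sup>2)"
  proof (rule Bochner_Integration.integrable_bound)
    have "(norm (v - u))\<^sup>2 \<le> 2 * (norm v)\<^sup>2 + 2 * (norm u)\<^sup>2" for u v :: "real ^ 'd"
    proof -
      have "(norm (v - u))\<^sup>2 \<le> (norm v + norm u)\<^sup>2"
        by (intro power_mono norm_triangle_ineq4) auto
      also have "\<dots> \<le> 2 * (norm v)\<^sup>2 + 2 * (norm u)\<^sup>2"
        using sum_squares_bound[of "norm v" "norm u"] by (simp add: power2_sum)
      finally show ?thesis .
    qed
    then show "AE \<omega> in M. norm ((norm (V \<omega> - expectation V))\<^sup>2) \<le> norm (2 * (norm (V \<omega>))\<^sup>2 + 2 * (norm (expectation V))\<^sup>2)"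
      by simp
  qed measurable
  have m: "(\<lambda>\<omega>. V \<omega> - expectation V) \<in> borel_measurable M" by measurable
  show "integrable M (\<lambda>\<omega>. ((V \<omega> - expectation V) \<bullet> x)\<^sup>2)"
    using integrable_inner_mult[OF m c, of x x] by (simp add: power2_eq_square)
  show "trace (A ** cov_matrix M V ** transpose A) = (\<Sum>a\<in>UNIV. expectation (\<lambda>\<omega>. ((V \<omega> - expectation V) \<bullet> (A $ a))\<^sup>2))"
    unfolding trace_conj cov_matrix_eq_second_moment[OF V]
    by (simp add: inner_second_moment[OF integrable_mult_components[OF m c]] power2_eq_square)
qed

text \<open>The risk with the estimator frozen: \<open>A\<close> stands for \<open>Q\<close> times
  the estimate and \<open>A0\<close> for \<open>Q\<close> times the true coefficients. The
  coefficient error meets the second moment of the sample mean, which does not grow with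
  \<open>N\<close>; the sampling error has variance of order 1/N.\<close>

lemma sample_mean_risk_bound:
  fixes X :: "'a \<Rightarrow> real ^ 'd" and V :: "nat \<Rightarrow> 'b \<Rightarrow> real ^ 'd" and A A0 :: "real ^ 'd ^ 'q"
  assumes "prob_space M" "prob_space P"
    and [measurable]: "X \<in> borel_measurable M" and int: "integrable M (\<lambda>\<omega>. (norm (X \<omega>))\<^sup>2)"
    and iid: "iid_samples P {1..N} V (distr M borel X)" and "N \<ge> 1"
  shows "(\<integral>\<^sup>+ \<omega>. ennreal ((norm (A *v ((1 / real N) *\<^sub>R (\<Sum>l = 1..N. V l \<omega>)) - A0 *v integral\<^sup>L M X))\<^sup>2) \<partial>P)
    \<le> ennreal (2 * (norm (A - A0))\<^sup>2 * (\<integral>\<omega>. (norm (X \<omega>))\<^sup>2 \<partial>M)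
        + 2 / real N * trace (A0 ** cov_matrix M X ** transpose A0))"
proof -
  interpret M: prob_space M by fact
  interpret P: prob_space P by fact
  note One_nat_def [simp del]
  have indep: "P.indep_vars (\<lambda>_. borel) V {1..N}" and law: "\<And>l. l \<in> {1..N} \<Longrightarrow> distr P borel (V l) = distr M borel X"
    using iid by (auto simp: iid_samples_def)
  have V [measurable]: "V l \<in> borel_measurable P" if "l \<in> {1..N}" for l
    using indep that unfolding P.indep_vars_def by blast
  define \<mu> where "\<mu> = integral\<^sup>L M X"
  have int_law: "integral\<^sup>L P (\<lambda>\<omega>. g (V l \<omega>)) = integral\<^sup>L M (\<lambda>\<omega>. g (X \<omega>))"
    "integrable P (\<lambda>\<omega>. g (V l \<omega>)) = integrable M (\<lambda>\<omega>. g (X \<omega>))"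
    if "l \<in> {1..N}" and [measurable]: "g \<in> borel_measurable borel" for l and g :: "real ^ 'd \<Rightarrow> real"
    using integral_distr[OF V[OF that(1)] that(2)] integral_distr[OF assms(3) that(2)]
      integrable_distr_eq[OF V[OF that(1)] that(2)] integrable_distr_eq[OF assms(3) that(2)]
    by (simp_all add: law[OF that(1)])
  note var = M.trace_conj_cov_matrix[OF assms(3,4), folded \<mu>_def]
  define Xb where "Xb \<omega> = (1 / real N) *\<^sub>R (\<Sum>l = 1..N. V l \<omega>)" for \<omega>
  have Xb_mu: "Xb \<omega> - \<mu> = (1 / real N) *\<^sub>R (\<Sum>l = 1..N. V l \<omega> - \<mu>)" for \<omega>
    using \<open>N \<ge> 1\<close> by (simp add: Xb_def sum_subtractf scaleR_diff_right sum_constant_scaleR del: sum_constant)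
  have var_Xb: "integrable P (\<lambda>\<omega>. ((Xb \<omega> - \<mu>) \<bullet> x)\<^sup>2)"
    "integral\<^sup>L P (\<lambda>\<omega>. ((Xb \<omega> - \<mu>) \<bullet> x)\<^sup>2) = 1 / real N * M.expectation (\<lambda>\<omega>. ((X \<omega> - \<mu>) \<bullet> x)\<^sup>2)" for x
  proof -
    define Y where "Y l \<omega> = (V l \<omega> - \<mu>) \<bullet> x" for l \<omega>
    have eq: "((Xb \<omega> - \<mu>) \<bullet> x)\<^sup>2 = (1 / real N)\<^sup>2 * (\<Sum>l = 1..N. Y l \<omega>)\<^sup>2" for \<omega>
      unfolding Xb_mu Y_def by (simp add: inner_sum_left power_mult_distrib power_divide)
    have ind: "P.indep_vars (\<lambda>_. borel) Y {1..N}"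
      unfolding Y_def by (rule P.indep_vars_compose2[OF indep]) measurable
    have Y2: "integrable P (\<lambda>\<omega>. (Y l \<omega>)\<^sup>2)"
      "integral\<^sup>L P (\<lambda>\<omega>. (Y l \<omega>)\<^sup>2) = M.expectation (\<lambda>\<omega>. ((X \<omega> - \<mu>) \<bullet> x)\<^sup>2)" if "l \<in> {1..N}" for l
      using int_law[OF that, of "\<lambda>z. ((z - \<mu>) \<bullet> x)\<^sup>2"] var(2)[of x] by (simp_all add: Y_def)
    have Y0: "integral\<^sup>L P (Y l) = 0" if "l \<in> {1..N}" for l
    proof -
      have "integral\<^sup>L P (Y l) = M.expectation (\<lambda>\<omega>. (X \<omega> - \<mu>) \<bullet> x)"
        using int_law(1)[OF that, of "\<lambda>z. (z - \<mu>) \<bullet> x"] by (simp add: Y_def[abs_def])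
      also have "\<dots> = 0"
        using var(1) by (simp add: inner_diff_left M.prob_space \<mu>_def)
      finally show ?thesis .
    qed
    note S = P.expectation_square_sum_indep[OF _ ind Y2(1) Y0]
    show "integrable P (\<lambda>\<omega>. ((Xb \<omega> - \<mu>) \<bullet> x)\<^sup>2)"
      unfolding eq using S by simp
    show "integral\<^sup>L P (\<lambda>\<omega>. ((Xb \<omega> - \<mu>) \<bullet> x)\<^sup>2) = 1 / real N * M.expectation (\<lambda>\<omega>. ((X \<omega> - \<mu>) \<bullet> x)\<^sup>2)"
      unfolding eq using S Y2(2) \<open>N \<ge> 1\<close> by (simp add: power2_eq_square)
  qed
  define T1 where "T1 \<omega> = 1 / real N * (\<Sum>l = 1..N. (norm (V l \<omega>))\<^sup>2)" for \<omega>
  have T1: "integrable P T1" "integral\<^sup>L P T1 = M.expectation (\<lambda>\<omega>. (norm (X \<omega>))\<^sup>2)"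
  proof -
    have *: "integrable P (\<lambda>\<omega>. (norm (V l \<omega>))\<^sup>2)"
      "P.expectation (\<lambda>\<omega>. (norm (V l \<omega>))\<^sup>2) = M.expectation (\<lambda>\<omega>. (norm (X \<omega>))\<^sup>2)" if "l \<in> {1..N}" for l
      using int_law[OF that, of "\<lambda>z. (norm z)\<^sup>2"] int by simp_all
    show "integrable P T1"
      unfolding T1_def[abs_def] by (intro integrable_mult_right Bochner_Integration.integrable_sum *)
    show "P.expectation T1 = M.expectation (\<lambda>\<omega>. (norm (X \<omega>))\<^sup>2)"
      unfolding T1_def[abs_def] using * \<open>N \<ge> 1\<close>
      by (simp add: Bochner_Integration.integral_sum del: sum_divide_distrib)
  qed
  \<comment> \<open>Convexity of the square: the squared norm of the mean is at most the mean of the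
    squared norms, whose expectation is the second moment of one sample.\<close>
  have Xb_le: "(norm (Xb \<omega>))\<^sup>2 \<le> T1 \<omega>" for \<omega>
  proof -
    have "(norm (Xb \<omega>))\<^sup>2 = (1 / real N)\<^sup>2 * (norm (\<Sum>l = 1..N. V l \<omega>))\<^sup>2"
      by (simp add: Xb_def power_mult_distrib power_divide)
    also have "(norm (\<Sum>l = 1..N. V l \<omega>))\<^sup>2 \<le> (\<Sum>l = 1..N. norm (V l \<omega>))\<^sup>2"
      by (intro power_mono norm_sum) auto
    also have "\<dots> \<le> (\<Sum>l = 1..N. (norm (V l \<omega>))\<^sup>2) * real N"
      using sum_squared_le_sum_of_squares[of "\<lambda>l. norm (V l \<omega>)" "{1..N}"] by simp
    finally show ?thesis
      using \<open>N \<ge> 1\<close> by (simp add: T1_def power2_eq_square divide_right_mono)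
  qed
  define T2 where "T2 \<omega> = (\<Sum>a\<in>UNIV. ((Xb \<omega> - \<mu>) \<bullet> (A0 $ a))\<^sup>2)" for \<omega>
  have T2: "integrable P T2" "integral\<^sup>L P T2 = 1 / real N * trace (A0 ** cov_matrix M X ** transpose A0)"
    unfolding T2_def[abs_def] var(3) using var_Xb by (simp_all add: sum_distrib_left)
  have le: "(norm (A *v Xb \<omega> - A0 *v \<mu>))\<^sup>2 \<le> 2 * (norm (A - A0))\<^sup>2 * T1 \<omega> + 2 * T2 \<omega>" for \<omega>
  proof -
    \<comment> \<open>The coefficient error is paired with the sample mean and the true coefficients
      with its centred version; the factor 2 in front of both terms comes from the square of a
      sum.\<close>
    have "A *v Xb \<omega> - A0 *v \<mu> = (A - A0) *v Xb \<omega> + A0 *v (Xb \<omega> - \<mu>)"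
      by (simp add: matrix_vector_mult_diff_distrib matrix_vector_mult_diff_rdistrib)
    then have "(norm (A *v Xb \<omega> - A0 *v \<mu>))\<^sup>2 \<le> (norm ((A - A0) *v Xb \<omega>) + norm (A0 *v (Xb \<omega> - \<mu>)))\<^sup>2"
      by (simp add: norm_triangle_ineq power_mono)
    also have "\<dots> \<le> 2 * (norm ((A - A0) *v Xb \<omega>))\<^sup>2 + 2 * (norm (A0 *v (Xb \<omega> - \<mu>)))\<^sup>2"
      using sum_squares_bound[of "norm ((A - A0) *v Xb \<omega>)" "norm (A0 *v (Xb \<omega> - \<mu>))"] by (simp add: power2_sum)
    also have "(norm (A0 *v (Xb \<omega> - \<mu>)))\<^sup>2 = T2 \<omega>"
      by (simp add: T2_def norm_vec_def L2_set_def sum_nonneg matrix_vector_mul_component inner_commute)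
    also have "(norm ((A - A0) *v Xb \<omega>))\<^sup>2 \<le> (norm (A - A0))\<^sup>2 * T1 \<omega>"
      by (rule order_trans[OF norm_matrix_vector_mult_le]) (intro mult_left_mono Xb_le, simp)
    finally show ?thesis by simp
  qed
  have "(\<integral>\<^sup>+ \<omega>. ennreal ((norm (A *v Xb \<omega> - A0 *v \<mu>))\<^sup>2) \<partial>P)
      \<le> (\<integral>\<^sup>+ \<omega>. ennreal (2 * (norm (A - A0))\<^sup>2 * T1 \<omega> + 2 * T2 \<omega>) \<partial>P)"
    by (intro nn_integral_mono ennreal_leI le)
  also have "\<dots> = ennreal (\<integral>\<omega>. 2 * (norm (A - A0))\<^sup>2 * T1 \<omega> + 2 * T2 \<omega> \<partial>P)"
    using T1(1) T2(1) order_trans[OF zero_le_power2 le] by (intro nn_integral_eq_integral AE_I2) auto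
  also have "(\<integral>\<omega>. 2 * (norm (A - A0))\<^sup>2 * T1 \<omega> + 2 * T2 \<omega> \<partial>P)
      = 2 * (norm (A - A0))\<^sup>2 * (\<integral>\<omega>. (norm (X \<omega>))\<^sup>2 \<partial>M) + 2 / real N * trace (A0 ** cov_matrix M X ** transpose A0)"
    using T1 T2 by simp
  finally show ?thesis unfolding Xb_def \<mu>_def .
qed

lemma indep_rv_commute:
  assumes "prob_space M" "indep_rv M A U B V"
  shows "indep_rv M B V A U"
proof -
  interpret prob_space M by fact
  have "indep_set S T" if "indep_set T S" for S T
    using that unfolding indep_sets2_eq by (metis Int_commute mult.commute)
  then show ?thesis using assms(2) unfolding indep_rv_def by auto
qed

lemma borel_measurable_matrix_vector_mult [measurable (raw)]:
  fixes f :: "'a \<Rightarrow> real ^ 'n ^ 'm" and g :: "'a \<Rightarrow> real ^ 'n"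
  assumes [measurable]: "f \<in> borel_measurable M" "g \<in> borel_measurable M"
  shows "(\<lambda>x. f x *v g x) \<in> borel_measurable M"
  by (intro borel_measurable_vec) (simp add: matrix_vector_mult_def)

lemma borel_measurable_regressor [measurable (raw)]:
  fixes \<sigma> :: "'s::finite \<Rightarrow> 'n::finite"
  assumes [measurable]: "f \<in> borel_measurable M"
  shows "(\<lambda>x. regressor \<sigma> (f x)) \<in> borel_measurable M"
proof (rule borel_measurable_vec)
  fix j :: "'s option"
  show "(\<lambda>x. regressor \<sigma> (f x) $ j) \<in> borel_measurable M"
    by (cases j) (simp_all add: regressor_def)
qed

lemma borel_measurable_ols:
  fixes f :: "'a \<Rightarrow> nat \<Rightarrow> real ^ 'd" and g :: "'a \<Rightarrow> nat \<Rightarrow> real ^ 'k"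
  assumes f: "\<And>l. l \<in> {1..m} \<Longrightarrow> (\<lambda>x. f x l) \<in> borel_measurable M"
    and g: "\<And>l. l \<in> {1..m} \<Longrightarrow> (\<lambda>x. g x l) \<in> borel_measurable M"
  shows "(\<lambda>x. ols m (f x) (g x)) \<in> borel_measurable M"
proof (intro borel_measurable_vec)
  fix a j
  have "(\<lambda>x. \<Sum>l = 1..m. g x l $ a * pinv_col m (f x) l $ j) \<in> borel_measurable M"
    by (intro borel_measurable_sum borel_measurable_times borel_measurable_vec_nth
        borel_measurable_pinv_col_nth f g)
  then show "(\<lambda>x. ols m (f x) (g x) $ a $ j) \<in> borel_measurable M" by (simp add: ols_def)
qed

lemma ols_cong:
  "(\<And>l. l \<in> {1..m} \<Longrightarrow> z l = z' l) \<Longrightarrow> (\<And>l. l \<in> {1..m} \<Longrightarrow> y l = y' l) \<Longrightarrow> ols m z y = ols m z' y'"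
  by (simp add: ols_def pinv_col_def gram_def)

text \<open>The estimator is a function of the exploration data, hence independent of the
  exploitation samples. The freezing lemma turns the conditional risk into an ordinary integral, to
  which the bound for a fixed matrix applies.\<close>

lemma cond_risk_beta_hat_bound:
  fixes XS :: "'a \<Rightarrow> real ^ ('s::finite option)" and Q :: "real ^ 'k ^ 'q" and \<beta> :: "real ^ ('s option) ^ 'k"
    and W :: "nat \<Rightarrow> 'b \<Rightarrow> (real ^ 'n) \<times> (real ^ 'k)" and \<sigma> :: "'s \<Rightarrow> 'n::finite"
  assumes "prob_space M" "prob_space P"
    and XS: "XS \<in> borel_measurable M" "integrable M (\<lambda>\<omega>. (norm (XS \<omega>))\<^sup>2)"
    and iid: "iid_samples P {1..N} V (distr M borel XS)" and "N \<ge> 1"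
    and indep: "indep_rv P (Pi\<^sub>M {1..m} (\<lambda>_. borel)) (\<lambda>\<omega>. \<lambda>l\<in>{1..m}. W l \<omega>)
                 (Pi\<^sub>M {1..N} (\<lambda>_. borel)) (\<lambda>\<omega>. \<lambda>l\<in>{1..N}. V l \<omega>)"
  shows "AE \<omega> in P. cond_risk P Q (\<beta> *v integral\<^sup>L M XS) (beta_hat \<sigma> m W) N V \<omega>
    \<le> ennreal (2 * (norm (Q ** (beta_hat \<sigma> m W \<omega> - \<beta>)))\<^sup>2 * (\<integral>\<omega>. (norm (XS \<omega>))\<^sup>2 \<partial>M)
        + 2 / real N * trace (cov_matrix M XS ** transpose \<beta> ** transpose Q ** Q ** \<beta>))"
proof -
  let ?bh = "beta_hat \<sigma> m W" and ?\<mu> = "integral\<^sup>L M XS"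
  \<comment> \<open>The estimator as a measurable map on the product space of exploration
    samples.\<close>
  define g where "g w = ols m (\<lambda>l. regressor \<sigma> (fst (w l))) (\<lambda>l. snd (w l))"
    for w :: "nat \<Rightarrow> (real ^ 'n) \<times> (real ^ 'k)"
  have g: "g \<in> measurable (Pi\<^sub>M {1..m} (\<lambda>_. borel)) borel"
  proof -
    have [measurable]: "(\<lambda>w. w l) \<in> measurable (Pi\<^sub>M {1..m} (\<lambda>_. borel :: ((real ^ 'n) \<times> (real ^ 'k)) measure)) (borel \<Otimes>\<^sub>M borel)"
      if "l \<in> {1..m}" for l using that unfolding borel_prod by measurable
    show ?thesis unfolding g_def by (rule borel_measurable_ols) measurable
  qed
  have bh: "?bh = (\<lambda>\<omega>. g (\<lambda>l\<in>{1..m}. W l \<omega>))"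
    unfolding g_def beta_hat_def by (intro ext ols_cong) auto
  have ind: "indep_rv P borel ?bh (Pi\<^sub>M {1..N} (\<lambda>_. borel)) (\<lambda>\<omega>. \<lambda>l\<in>{1..N}. V l \<omega>)"
    unfolding bh by (rule indep_rv_compose[OF indep g \<open>prob_space P\<close>])
  \<comment> \<open>The squared error as a function of the estimate and the exploitation samples,
    the two independent arguments.\<close>
  define \<phi> where "\<phi> x = ennreal ((norm (Q *v ((1 / real N) *\<^sub>R (\<Sum>l = 1..N. fst x *v snd x l) - \<beta> *v ?\<mu>)))\<^sup>2)"
    for x :: "(real ^ ('s option) ^ 'k) \<times> (nat \<Rightarrow> real ^ ('s option))"
  have [measurable]: "(\<lambda>x. snd x l) \<in> borel_measurable (borel \<Otimes>\<^sub>M Pi\<^sub>M {1..N} (\<lambda>_. borel))" if "l \<in> {1..N}"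
    for l using that by measurable
  have \<phi>: "\<phi> \<in> borel_measurable (borel \<Otimes>\<^sub>M Pi\<^sub>M {1..N} (\<lambda>_. borel))"
    unfolding \<phi>_def by measurable
  have sum: "\<phi> (b, \<lambda>l\<in>{1..N}. V l \<omega>)
    = ennreal ((norm ((Q ** b) *v ((1 / real N) *\<^sub>R (\<Sum>l = 1..N. V l \<omega>)) - (Q ** \<beta>) *v ?\<mu>))\<^sup>2)" for b \<omega>
  proof -
    have "(\<Sum>l = 1..N. b *v (\<lambda>l\<in>{1..N}. V l \<omega>) l) = b *v (\<Sum>l = 1..N. V l \<omega>)"
      by (simp add: linear_sum[OF matrix_vector_mul_linear])
    then show ?thesis
      by (simp add: \<phi>_def matrix_vector_mult_diff_distrib matrix_vector_mult_scaleR matrix_vector_mul_assoc)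
  qed
  have "cond_risk P Q (\<beta> *v ?\<mu>) ?bh N V
      = nn_cond_exp P (vimage_algebra (space P) ?bh borel) (\<lambda>\<omega>. \<phi> (?bh \<omega>, \<lambda>l\<in>{1..N}. V l \<omega>))"
    unfolding cond_risk_def
    by (intro arg_cong[where f = "nn_cond_exp P (vimage_algebra (space P) ?bh borel)"] ext)
      (simp add: \<phi>_def lrmc_def)
  with nn_cond_exp_indep_rv[OF \<open>prob_space P\<close> ind \<phi>]
  have "AE \<omega> in P. cond_risk P Q (\<beta> *v ?\<mu>) ?bh N V \<omega> = (\<integral>\<^sup>+ \<omega>'. \<phi> (?bh \<omega>, \<lambda>l\<in>{1..N}. V l \<omega>') \<partial>P)"
    by simp
  then show ?thesis
  proof eventually_elim
    case (elim \<omega>)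
    have "Q ** ?bh \<omega> - Q ** \<beta> = Q ** (?bh \<omega> - \<beta>)"
      by (simp add: matrix_matrix_mult_def vec_eq_iff right_diff_distrib sum_subtractf)
    then show ?case
      using sample_mean_risk_bound[OF assms(1,2) XS iid \<open>N \<ge> 1\<close>, of "Q ** ?bh \<omega>" "Q ** \<beta>"]
      unfolding elim sum trace_gram_conj by simp
  qed
qed

theorem theorem6p1:
  fixes M :: "'a measure"
    and X :: "'a \<Rightarrow> real ^ 'n"
    and fY :: "'a \<Rightarrow> real ^ 'k"
    and c0 :: real and c :: "'n \<Rightarrow> real"
    and S :: "'n set" and \<sigma> :: "'s::finite \<Rightarrow> 'n"
    and XS :: "'a \<Rightarrow> real ^ ('s option)"
    and Q :: "real ^ 'k ^ 'q"
    and \<beta> :: "real ^ ('s option) ^ 'k"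
    and \<epsilon> :: "'a \<Rightarrow> real ^ 'k"
    and K :: real
  assumes "prob_space M"
    and "X \<in> borel_measurable M" and "fY \<in> borel_measurable M"
    and "c0 > 0" and "\<And>i. c i > 0"
    and "S \<noteq> {}" and "bij_betw \<sigma> UNIV S"
    and "XS = (\<lambda>\<omega>. regressor \<sigma> (X \<omega>))"
    and "AE \<omega> in M. fY \<omega> = \<beta> *v XS \<omega> + \<epsilon> \<omega>"
    and "sub_gaussian_vec M \<epsilon>"
    and "integral\<^sup>L M \<epsilon> = 0"
    and "indep_rv M borel \<epsilon> borel XS"
    and "K \<ge> 1"
    and "max (SUP \<theta>\<in>sphere 0 1. ennreal (root 4 (\<integral>\<omega>. (XS \<omega> \<bullet> \<theta>) ^ 4 \<partial>M)))
             (psi_norm M 1 (\<lambda>\<omega>. norm (XS \<omega>))) \<le> ennreal K"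
    and "invertible (second_moment_matrix M XS)"
  shows "\<exists>C>0. \<exists>m0::nat. \<forall>m\<ge>m0. \<forall>B>0. \<forall>(P :: 'b measure) W V.
    (let N = num_exploit c0 c S B m; bh = beta_hat \<sigma> m W in
      m > CARD('n) + 1 \<longrightarrow> N \<ge> 1 \<longrightarrow>
      prob_space P \<longrightarrow>
      iid_samples P {1..m} W (distr M borel (\<lambda>\<omega>. (X \<omega>, fY \<omega>))) \<longrightarrow>
      (AE \<omega> in P. full_column_rank m (\<lambda>l. regressor \<sigma> (fst (W l \<omega>)))) \<longrightarrow>
      iid_samples P {1..N} V (distr M borel XS) \<longrightarrow>
      indep_rv P (Pi\<^sub>M {1..m} (\<lambda>_. borel)) (\<lambda>\<omega>. \<lambda>l\<in>{1..m}. W l \<omega>)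
                 (Pi\<^sub>M {1..N} (\<lambda>_. borel)) (\<lambda>\<omega>. \<lambda>l\<in>{1..N}. V l \<omega>) \<longrightarrow>
      measure P {\<omega> \<in> space P.
        cond_risk P Q (integral\<^sup>L M fY) bh N V \<omega>
          \<le> ennreal (C * (1 / real N * trace (cov_matrix M XS ** transpose \<beta> ** transpose Q ** Q ** \<beta>)
               + (real (card S) + 1) * trace (Q ** cov_matrix M \<epsilon> ** transpose Q) * (ln (real m) / real m)))}
        \<ge> 1 - 1 / (real m)\<^sup>2)"
proof -

  \<comment> \<open>Moments of regressor and noise, and their joint law\<close>
  interpret M: prob_space M by fact
  note One_nat_def [simp del]
  note XS_def = assms(8)
  have X [measurable]: "X \<in> borel_measurable M" and fY [measurable]: "fY \<in> borel_measurable M" by fact+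
  have XS [measurable]: "XS \<in> borel_measurable M" unfolding XS_def by measurable
  have \<epsilon> [measurable]: "\<epsilon> \<in> borel_measurable M"
    using assms(10) by (simp add: sub_gaussian_vec_def)
  have "psi_norm M 1 (\<lambda>\<omega>. norm (XS \<omega>)) < \<infinity>"
    using assms(14) by (auto intro: le_less_trans)
  then have intX: "integrable M (\<lambda>\<omega>. (norm (XS \<omega>))\<^sup>2)"
    using M.square_integrable_if_psi_norm_finite[of "\<lambda>\<omega>. norm (XS \<omega>)" 1] by simp
  have psi\<epsilon>: "psi_norm M 2 (\<lambda>\<omega>. \<epsilon> \<omega> $ a) < \<infinity>" for a
  proof -
    have "psi_norm M 2 (\<lambda>\<omega>. \<epsilon> \<omega> \<bullet> axis a 1) \<le> (SUP \<theta>\<in>sphere 0 1. psi_norm M 2 (\<lambda>\<omega>. \<epsilon> \<omega> \<bullet> \<theta>))"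
      by (intro SUP_upper) simp
    then show ?thesis
      using assms(10) by (auto simp: sub_gaussian_vec_def inner_axis intro: le_less_trans)
  qed
  have "integrable M (\<lambda>\<omega>. \<Sum>a\<in>UNIV. (\<epsilon> \<omega> $ a)\<^sup>2)"
    by (intro Bochner_Integration.integrable_sum M.square_integrable_if_psi_norm_finite[OF _ psi\<epsilon>]) auto
  then have int\<epsilon>: "integrable M (\<lambda>\<omega>. (norm (\<epsilon> \<omega>))\<^sup>2)"
    by (simp add: norm_vec_def L2_set_def sum_nonneg)
  note cov\<epsilon> = M.trace_conj_cov_matrix[OF \<epsilon> int\<epsilon>] and covX = M.trace_conj_cov_matrix[OF XS intX]
  have "\<exists>b>0. \<forall>t. (\<integral>\<^sup>+ \<omega>. ennreal (exp (t * \<epsilon> \<omega> $ a)) \<partial>M) \<le> ennreal (exp (b * t\<^sup>2))" for a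
    using M.sub_gaussian_mgf_bound[OF _ psi\<epsilon>, of a] integral_vec_nth[OF cov\<epsilon>(1), of a] assms(11)
    by (metis borel_measurable_vec_nth \<epsilon> zero_index)
  then obtain b where b: "\<And>a. b a > 0"
    "\<And>a t. (\<integral>\<^sup>+ \<omega>. ennreal (exp (t * \<epsilon> \<omega> $ a)) \<partial>M) \<le> ennreal (exp (b a * t\<^sup>2))"
    by metis
  define D1 where "D1 = distr M borel XS"
  define D2 where "D2 = distr M borel \<epsilon>"
  have prob_D: "prob_space D1" "prob_space D2"
    unfolding D1_def D2_def by (auto intro!: M.prob_space_distr)
  have D12: "distr M (borel \<Otimes>\<^sub>M borel) (\<lambda>\<omega>. (XS \<omega>, \<epsilon> \<omega>)) = D1 \<Otimes>\<^sub>M D2"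
    unfolding D1_def D2_def
    by (rule indep_rv_distr_pair[OF \<open>prob_space M\<close> indep_rv_commute[OF \<open>prob_space M\<close> assms(12)]])
  \<comment> \<open>The sum of the coordinatewise constants serves as one constant for all
    coordinates.\<close>
  have mgf: "(\<integral>\<^sup>+ e. ennreal (exp (t * e $ a)) \<partial>D2) \<le> ennreal (exp (sum b UNIV * t\<^sup>2))" for a t
  proof -
    have "(\<integral>\<^sup>+ e. ennreal (exp (t * e $ a)) \<partial>D2) = (\<integral>\<^sup>+ \<omega>. ennreal (exp (t * \<epsilon> \<omega> $ a)) \<partial>M)"
      unfolding D2_def by (subst nn_integral_distr) auto
    also have "\<dots> \<le> ennreal (exp (b a * t\<^sup>2))" by (rule b)
    also have "\<dots> \<le> ennreal (exp (sum b UNIV * t\<^sup>2))"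
    proof -
      have "b a \<le> sum b UNIV" using b(1) by (intro member_le_sum) (auto intro: less_imp_le)
      then show ?thesis by (intro ennreal_leI) (simp add: mult_right_mono)
    qed
    finally show ?thesis .
  qed
  obtain c' R where cR: "c' > 0" "R > 0"
    "\<And>y. c' * (norm y)\<^sup>2 \<le> (\<Sum>i\<in>UNIV. \<Sum>j\<in>UNIV. (y $ i * y $ j) * M.expectation (\<lambda>\<omega>. trunc_prod R i j (XS \<omega>)))"
    using M.truncated_second_moment_coercive[OF XS intX assms(15)] by blast
  have "(\<integral>z. trunc_prod R i j z \<partial>D1) = M.expectation (\<lambda>\<omega>. trunc_prod R i j (XS \<omega>))" for i j
    unfolding D1_def by (subst integral_distr) auto
  then obtain A \<kappa> m1 where A: "A > 0" "\<kappa> > 0" and conc: "\<And>m. m \<ge> m1 \<Longrightarrow>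
    \<exists>G\<in>sets (PiM {1..m} (\<lambda>_. D1 \<Otimes>\<^sub>M D2)).
      measure (PiM {1..m} (\<lambda>_. D1 \<Otimes>\<^sub>M D2)) G \<ge> 1 - 1 / (real m)\<^sup>2 \<and>
      (\<forall>w\<in>G. (\<forall>y. \<kappa> * real m * (norm y)\<^sup>2 \<le> (\<Sum>l = 1..m. (fst (w l) \<bullet> y)\<^sup>2)) \<and>
       (\<forall>a j. (\<Sum>l = 1..m. snd (w l) $ a * pinv_col m (\<lambda>l. fst (w l)) l $ j)\<^sup>2 \<le> A * (ln (real m) / real m)))"
    using regression_noise_concentration[OF prob_D _ _ mgf _ cR(1,2)] cR(3) b(1)
    by (auto simp: D1_def D2_def eventually_sequentially sum_pos)

  \<comment> \<open>Constants of the risk bound\<close>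
  define E2 where "E2 = M.expectation (\<lambda>\<omega>. (norm (XS \<omega>))\<^sup>2)"
  define T1 where "T1 = trace (cov_matrix M XS ** transpose \<beta> ** transpose Q ** Q ** \<beta>)"
  define T2 where "T2 = trace (Q ** cov_matrix M \<epsilon> ** transpose Q)"
  have T1: "T1 \<ge> 0" unfolding T1_def trace_gram_conj covX(3) by (intro sum_nonneg) simp
  have T2_eq: "T2 = (\<Sum>a\<in>UNIV. M.expectation (\<lambda>\<omega>. (\<epsilon> \<omega> \<bullet> (Q $ a))\<^sup>2))"
    unfolding T2_def cov\<epsilon>(3) by (simp add: assms(11))
  then have T2: "T2 \<ge> 0" by (simp add: sum_nonneg)
  have E2: "E2 \<ge> 0" by (simp add: E2_def)
  define k d where "k = real CARD('k)" and "d = real CARD('s option)"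
  \<comment> \<open>\<open>C0\<close> times ln m / m bounds the coefficient part of the risk:
    \<open>k * d\<close> entries, each with squared error at most \<open>A\<close> times ln m /
    m.\<close>
  define C0 where "C0 = 2 * E2 * (norm Q)\<^sup>2 * (k * d * A)"
  \<comment> \<open>For positive \<open>T2\<close> the quotient makes \<open>C * T2\<close> exceed
    \<open>C0\<close>. For \<open>T2 = 0\<close> division by zero yields 0, so \<open>C\<close> is
    2; that case is settled by the vanishing of the error.\<close>
  define C where "C = 2 + C0 / T2"
  have "C0 \<ge> 0" using E2 A by (simp add: C0_def k_def d_def)
  then have C: "C \<ge> 2" using T2 by (simp add: C_def)
  have mean: "integral\<^sup>L M fY = \<beta> *v integral\<^sup>L M XS"
  proof -
    have "integral\<^sup>L M fY = (\<integral>\<omega>. \<beta> *v XS \<omega> + \<epsilon> \<omega> \<partial>M)"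
      using assms(9) by (intro integral_cong_AE) auto
    also have "\<dots> = (\<integral>\<omega>. \<beta> *v XS \<omega> \<partial>M) + (\<integral>\<omega>. \<epsilon> \<omega> \<partial>M)"
      using covX(1) cov\<epsilon>(1)
      by (intro Bochner_Integration.integral_add integrable_bounded_linear[OF matrix_vector_mul_bounded_linear])
    also have "\<dots> = \<beta> *v integral\<^sup>L M XS"
      using integral_bounded_linear[OF matrix_vector_mul_bounded_linear covX(1), of \<beta>] assms(11) by simp
    finally show ?thesis .
  qed
  \<comment> \<open>Stated for an arbitrary \<open>N\<close> \<ge> 1, since the budget acts through
    the number of exploitation samples. The lower bound 1 on \<open>m\<close> keeps ln m nonnegative
    and the index set nonempty.\<close>
  have main: "measure P {\<omega> \<in> space P. cond_risk P Q (integral\<^sup>L M fY) (beta_hat \<sigma> m W) N V \<omega>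
      \<le> ennreal (C * (1 / real N * T1 + (real (card S) + 1) * T2 * (ln (real m) / real m)))} \<ge> 1 - 1 / (real m)\<^sup>2"
    if m: "m \<ge> max 1 m1" and N: "N \<ge> 1" and P: "prob_space P"
      and W: "iid_samples P {1..m} W (distr M borel (\<lambda>\<omega>. (X \<omega>, fY \<omega>)))"
      and V: "iid_samples P {1..N} V (distr M borel XS)"
      and ind: "indep_rv P (Pi\<^sub>M {1..m} (\<lambda>_. borel)) (\<lambda>\<omega>. \<lambda>l\<in>{1..m}. W l \<omega>)
                 (Pi\<^sub>M {1..N} (\<lambda>_. borel)) (\<lambda>\<omega>. \<lambda>l\<in>{1..N}. V l \<omega>)"
    for m N and P :: "'b measure" and W V
  proof -

    \<comment> \<open>Law of the regressor-residual pairs in the exploration data\<close>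
    interpret P: prob_space P by fact
    have m': "m \<ge> 1" "m \<ge> m1" using m by auto
    define L where "L = ln (real m) / real m"
    have L: "L \<ge> 0" using m' by (simp add: L_def)
    \<comment> \<open>Sends a sample to its regressor and its residual. By the linear model the
      residual has the role of the noise almost surely, so the image law is the product
      \<open>D1 \<Otimes>\<^sub>M D2\<close>.\<close>
    define f where "f w = (regressor \<sigma> (fst w), snd w - \<beta> *v regressor \<sigma> (fst w))" for w :: "(real ^ 'n) \<times> (real ^ 'k)"
    have f [measurable]: "f \<in> measurable borel (borel \<Otimes>\<^sub>M borel)"
      unfolding f_def borel_prod[symmetric] by measurable
    have W_ind: "P.indep_vars (\<lambda>_. borel) W {1..m}"
      and W_law: "\<And>l. l \<in> {1..m} \<Longrightarrow> distr P borel (W l) = distr M borel (\<lambda>\<omega>. (X \<omega>, fY \<omega>))"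
      using W by (auto simp: iid_samples_def)
    have W_meas [measurable]: "W l \<in> measurable P borel" if "l \<in> {1..m}" for l
      using W_ind that unfolding P.indep_vars_def by blast
    define U where "U l \<omega> = f (W l \<omega>)" for l \<omega>
    have U_meas [measurable]: "U l \<in> measurable P (borel \<Otimes>\<^sub>M borel)" if "l \<in> {1..m}" for l
      using measurable_compose[OF W_meas[OF that] f] by (simp add: U_def[abs_def])
    have XfY [measurable]: "(\<lambda>\<omega>. (X \<omega>, fY \<omega>)) \<in> measurable M borel"
      unfolding borel_prod[symmetric] by measurable
    have U_law: "distr P (borel \<Otimes>\<^sub>M borel) (U l) = D1 \<Otimes>\<^sub>M D2" if "l \<in> {1..m}" for l
    proof -
      have "distr P (borel \<Otimes>\<^sub>M borel) (U l) = distr (distr P borel (W l)) (borel \<Otimes>\<^sub>M borel) f"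
        using that by (subst distr_distr) (auto simp: U_def[abs_def] comp_def)
      also have "\<dots> = distr M (borel \<Otimes>\<^sub>M borel) (\<lambda>\<omega>. f (X \<omega>, fY \<omega>))"
        unfolding W_law[OF that] by (subst distr_distr) (auto simp: comp_def)
      also have "\<dots> = distr M (borel \<Otimes>\<^sub>M borel) (\<lambda>\<omega>. (XS \<omega>, \<epsilon> \<omega>))"
      proof (rule distr_cong_AE)
        show "AE \<omega> in M. f (X \<omega>, fY \<omega>) = (XS \<omega>, \<epsilon> \<omega>)"
          using assms(9) by eventually_elim (simp add: f_def XS_def)
      qed (auto intro: measurable_compose[OF XfY f])
      finally show ?thesis unfolding D12 .
    qed
    let ?B = "PiM {1..m} (\<lambda>_. (borel :: (real ^ ('s option)) measure) \<Otimes>\<^sub>M (borel :: (real ^ 'k) measure))"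
    let ?N = "PiM {1..m} (\<lambda>_. D1 \<Otimes>\<^sub>M D2)"
    define Uv where "Uv \<omega> = (\<lambda>l\<in>{1..m}. U l \<omega>)" for \<omega>
    have Uv [measurable]: "Uv \<in> measurable P ?B"
      unfolding Uv_def by (rule measurable_restrict) (rule U_meas)
    have Uv_law: "distr P ?B Uv = ?N"
    proof -
      have "P.indep_vars (\<lambda>_. borel \<Otimes>\<^sub>M borel) U {1..m}"
        unfolding U_def by (rule P.indep_vars_compose2[OF W_ind]) (rule f)
      then have "distr P ?B Uv = (\<Pi>\<^sub>M l\<in>{1..m}. distr P (borel \<Otimes>\<^sub>M borel) (U l))"
        unfolding Uv_def using m' by (subst (asm) P.indep_vars_iff_distr_eq_PiM') auto
      also have "\<dots> = ?N" by (intro PiM_cong refl U_law)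
      finally show ?thesis .
    qed

    \<comment> \<open>Estimation error on the pulled-back good event\<close>
    obtain G where G: "G \<in> sets ?N" "measure ?N G \<ge> 1 - 1 / (real m)\<^sup>2"
      and G_coercive: "\<And>w y. w \<in> G \<Longrightarrow> \<kappa> * real m * (norm y)\<^sup>2 \<le> (\<Sum>l = 1..m. (fst (w l) \<bullet> y)\<^sup>2)"
      and G_noise: "\<And>w a j. w \<in> G \<Longrightarrow> (\<Sum>l = 1..m. snd (w l) $ a * pinv_col m (\<lambda>l. fst (w l)) l $ j)\<^sup>2 \<le> A * L"
      using conc[OF m'(2)] unfolding L_def by blast
    have sets_G [measurable]: "G \<in> sets ?B" using G(1) unfolding Uv_law[symmetric] by simp
    have prob_G: "P.prob {\<omega> \<in> space P. Uv \<omega> \<in> G} \<ge> 1 - 1 / (real m)\<^sup>2"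
    proof -
      have "measure ?N G = P.prob (Uv -` G \<inter> space P)"
        unfolding Uv_law[symmetric] by (rule measure_distr) measurable
      also have "Uv -` G \<inter> space P = {\<omega> \<in> space P. Uv \<omega> \<in> G}" by auto
      finally show ?thesis using G(2) by simp
    qed
    define \<Delta> where "\<Delta> \<omega> = beta_hat \<sigma> m W \<omega> - \<beta>" for \<omega>
    have \<Delta>: "\<Delta> \<omega> = (\<chi> a j. \<Sum>l = 1..m. snd (Uv \<omega> l) $ a * pinv_col m (\<lambda>l. fst (Uv \<omega> l)) l $ j)"
      if "Uv \<omega> \<in> G" for \<omega>
    proof -
      let ?Z = "\<lambda>l. regressor \<sigma> (fst (W l \<omega>))"
      have fst_Uv: "fst (Uv \<omega> l) = ?Z l" "snd (Uv \<omega> l) = snd (W l \<omega>) - \<beta> *v ?Z l" if "l \<in> {1..m}" for l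
        using that by (simp_all add: Uv_def U_def f_def)
      have "\<kappa> * real m * (norm y)\<^sup>2 \<le> (\<Sum>l = 1..m. (?Z l \<bullet> y)\<^sup>2)" for y
        using G_coercive[OF that, of y] fst_Uv(1) by simp
      then have "\<Delta> \<omega> = (\<chi> a j. \<Sum>l = 1..m. (snd (W l \<omega>) - \<beta> *v ?Z l) $ a * pinv_col m ?Z l $ j)"
        unfolding \<Delta>_def beta_hat_def by (rule ols_error) (use A m' in simp)
      also have "\<dots> = (\<chi> a j. \<Sum>l = 1..m. snd (Uv \<omega> l) $ a * pinv_col m (\<lambda>l. fst (Uv \<omega> l)) l $ j)"
      proof -
        have "pinv_col m (\<lambda>l. fst (Uv \<omega> l)) l = pinv_col m ?Z l" if "l \<in> {1..m}" for l
          using that by (intro pinv_col_cong fst_Uv)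
        then show ?thesis by (simp add: vec_eq_iff fst_Uv(2))
      qed
      finally show ?thesis .
    qed
    have \<Delta>_norm: "2 * (norm (Q ** \<Delta> \<omega>))\<^sup>2 * E2 \<le> C0 * L" if "Uv \<omega> \<in> G" for \<omega>
    proof -
      have "(norm (\<Delta> \<omega>))\<^sup>2 = (\<Sum>a\<in>UNIV. \<Sum>j\<in>UNIV. (\<Delta> \<omega> $ a $ j)\<^sup>2)"
        by (simp add: norm_vec_def L2_set_def sum_nonneg)
      also have "\<dots> \<le> (\<Sum>a\<in>(UNIV :: 'k set). \<Sum>j\<in>(UNIV :: 's option set). A * L)"
        unfolding \<Delta>[OF that] by (intro sum_mono) (simp add: G_noise[OF that])
      also have "\<dots> = k * d * A * L" by (simp add: k_def d_def)
      finally have "(norm Q)\<^sup>2 * (norm (\<Delta> \<omega>))\<^sup>2 \<le> (norm Q)\<^sup>2 * (k * d * A * L)"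
        by (intro mult_left_mono) auto
      then have "(norm (Q ** \<Delta> \<omega>))\<^sup>2 \<le> (norm Q)\<^sup>2 * (k * d * A * L)"
        using norm_matrix_mult_le[of Q "\<Delta> \<omega>"] by linarith
      then have "2 * E2 * (norm (Q ** \<Delta> \<omega>))\<^sup>2 \<le> 2 * E2 * ((norm Q)\<^sup>2 * (k * d * A * L))"
        using E2 by (intro mult_left_mono) auto
      then show ?thesis by (simp add: C0_def mult_ac)
    qed
    \<comment> \<open>With \<open>T2 = 0\<close> the bound has no noise term left, so the error
      itself must vanish. All rows of \<open>Q\<close> annihilate the noise almost surely, this
      passes to the residuals through their law, and \<open>Q ** \<Delta> \<omega>\<close> is linear
      in the residuals.\<close>
    have degenerate: "AE \<omega> in P. Uv \<omega> \<in> G \<longrightarrow> Q ** \<Delta> \<omega> = 0" if "T2 = 0"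
    proof -
      have "AE e in M. \<epsilon> e \<bullet> (Q $ a) = 0" for a
      proof -
        have "M.expectation (\<lambda>\<omega>. (\<epsilon> \<omega> \<bullet> (Q $ a))\<^sup>2) = 0"
          using that unfolding T2_eq by (subst (asm) sum_nonneg_eq_0_iff) auto
        then have "AE \<omega> in M. (\<epsilon> \<omega> \<bullet> (Q $ a))\<^sup>2 = 0"
          using cov\<epsilon>(2)[of "Q $ a"] assms(11) by (subst (asm) integral_nonneg_eq_0_iff_AE) auto
        then show ?thesis by simp
      qed
      then have "AE x in distr M (borel \<Otimes>\<^sub>M borel) (\<lambda>\<omega>. (XS \<omega>, \<epsilon> \<omega>)). snd x \<bullet> (Q $ a) = 0" for a
        by (subst AE_distr_iff) auto
      then have "AE \<omega> in P. snd (U l \<omega>) \<bullet> (Q $ a) = 0" if "l \<in> {1..m}" for l a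
        unfolding D12 U_law[OF that, symmetric] using U_meas[OF that] by (subst (asm) AE_distr_iff) auto
      then have "AE \<omega> in P. \<forall>l\<in>{1..m}. \<forall>a\<in>UNIV. snd (U l \<omega>) \<bullet> (Q $ a) = 0"
        by (intro AE_finite_allI) auto
      then show ?thesis
      proof eventually_elim
        case (elim \<omega>)
        show ?case
        proof
          assume G: "Uv \<omega> \<in> G"
          have "(Q ** \<Delta> \<omega>) $ a $ j = 0" for a j
          proof -
            have "(Q ** \<Delta> \<omega>) $ a $ j = (\<Sum>i\<in>UNIV. \<Sum>l = 1..m. Q $ a $ i * (snd (Uv \<omega> l) $ i * pinv_col m (\<lambda>l. fst (Uv \<omega> l)) l $ j))"
              by (simp add: matrix_matrix_mult_def \<Delta>[OF G] sum_distrib_left)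
            also have "\<dots> = (\<Sum>l = 1..m. (snd (Uv \<omega> l) \<bullet> (Q $ a)) * pinv_col m (\<lambda>l. fst (Uv \<omega> l)) l $ j)"
              by (subst sum.swap) (simp add: inner_vec_def sum_distrib_left sum_distrib_right mult_ac)
            also have "\<dots> = 0" using elim by (intro sum.neutral) (simp add: Uv_def)
            finally show ?thesis .
          qed
          then show "Q ** \<Delta> \<omega> = 0" by (simp add: vec_eq_iff)
        qed
      qed
    qed

    \<comment> \<open>Comparison of the conditional risk with the claimed bound\<close>
    have "AE \<omega> in P. Uv \<omega> \<in> G \<longrightarrow> 2 * (norm (Q ** \<Delta> \<omega>))\<^sup>2 * E2 \<le> C * T2 * L"
    proof (cases "T2 = 0")
      case True
      show ?thesis using degenerate[OF True] by eventually_elim (simp add: True)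
    next
      case False
      \<comment> \<open>Here \<open>C * T2\<close> equals \<open>2 * T2 + C0\<close>.\<close>
      then have "C0 * L \<le> C * T2 * L"
        using T2 L by (intro mult_right_mono) (auto simp: C_def field_simps)
      then show ?thesis using \<Delta>_norm by (auto intro: order_trans)
    qed
    moreover have "AE \<omega> in P. cond_risk P Q (\<beta> *v integral\<^sup>L M XS) (beta_hat \<sigma> m W) N V \<omega>
        \<le> ennreal (2 * (norm (Q ** \<Delta> \<omega>))\<^sup>2 * E2 + 2 / real N * T1)"
      unfolding \<Delta>_def E2_def T1_def
      by (rule cond_risk_beta_hat_bound[OF \<open>prob_space M\<close> P XS intX V N ind])
    ultimately have good: "AE \<omega> in P. Uv \<omega> \<in> G \<longrightarrow> cond_risk P Q (integral\<^sup>L M fY) (beta_hat \<sigma> m W) N V \<omega>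
        \<le> ennreal (C * (1 / real N * T1 + (real (card S) + 1) * T2 * L))"
    proof eventually_elim
      case (elim \<omega>)
      show ?case
      proof
        assume "Uv \<omega> \<in> G"
        \<comment> \<open>The dimension factor is at least 1, so inserting it enlarges the
          bound.\<close>
        have "C * T2 * L * 1 \<le> C * T2 * L * (real (card S) + 1)"
          using C T2 L by (intro mult_left_mono) auto
        moreover have "2 / real N * T1 \<le> C * (1 / real N * T1)"
          using mult_right_mono[OF C, of "1 / real N * T1"] T1 by simp
        ultimately have "2 * (norm (Q ** \<Delta> \<omega>))\<^sup>2 * E2 + 2 / real N * T1
            \<le> C * (1 / real N * T1 + (real (card S) + 1) * T2 * L)"
          using elim(1) \<open>Uv \<omega> \<in> G\<close> by (simp add: algebra_simps)
        then show "cond_risk P Q (integral\<^sup>L M fY) (beta_hat \<sigma> m W) N V \<omega>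
            \<le> ennreal (C * (1 / real N * T1 + (real (card S) + 1) * T2 * L))"
          unfolding mean by (rule order_trans[OF elim(2) ennreal_leI])
      qed
    qed
    have [measurable]: "cond_risk P Q (integral\<^sup>L M fY) (beta_hat \<sigma> m W) N V \<in> borel_measurable P"
      unfolding cond_risk_def by (rule borel_measurable_nn_cond_exp2)
    \<comment> \<open>Up to a null set the good event lies inside the event of the claim, so its
      probability is a lower bound.\<close>
    have "P.prob {\<omega> \<in> space P. Uv \<omega> \<in> G} \<le> P.prob {\<omega> \<in> space P. cond_risk P Q (integral\<^sup>L M fY) (beta_hat \<sigma> m W) N V \<omega>
      \<le> ennreal (C * (1 / real N * T1 + (real (card S) + 1) * T2 * L))}"
      using good by (intro P.finite_measure_mono_AE) auto
    then show ?thesis using prob_G unfolding L_def by linarith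
  qed
  \<comment> \<open>\<open>C\<close> and \<open>max 1 m1\<close> were fixed before the sample size,
    the budget and the sampling space, as the order of quantifiers demands.\<close>
  show ?thesis
    unfolding Let_def T1_def[symmetric] T2_def[symmetric]
    using C main by (intro exI[of _ C] conjI exI[of _ "max 1 m1"]) auto
qed

end
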